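(* Let $G$ be a non-elementary subgroup of $PU(1,n;\mathbb{C})$, let $h\in G$ be a loxodromic element with fixed points $x_0\neq y_0$, and let $G(x_0,y_0)=\{f\in G:\{x_0,y_0\}\subset\mathrm{fix}(f)\}$. Then $G$ is discrete if and only if (1) $G(x_0,y_0)$ satisfies Condition A, and (2) every subgroup of $G$ generated by two loxodromic elements of $G$ is discrete.
   Context: $PU(1,n;\mathbb{C})$ ($n\ge 1$) is the projectivized group of linear automorphisms of $\mathbb{C}^{n+1}$ preserving a Hermitian form of signature $(1,n)$; it acts by holomorphic isometries on complex hyperbolic space $H^n_{\mathbb{C}}$ and continuously on its closure $\overline{H^n_{\mathbb{C}}}=H^n_{\mathbb{C}}\cup\partial H^n_{\mathbb{C}}$. It carries the topology induced from the matrix group; a subgroup is discrete if it is discrete in this topology, and $I$ denotes the identity. A non-trivial element $g$ is elliptic if it has a fixed point in $H^n_{\mathbb{C}}$; parabolic if it has exactly one fixed point in $\overline{H^n_{\mathbb{C}}}$ and it lies on $\partial H^n_{\mathbb{C}}$; loxodromic if it has exactly two fixed points in $\overline{H^n_{\mathbb{C}}}$ and both lie on $\partial H^n_{\mathbb{C}}$. A subgroup is non-elementary if it contains two non-elliptic elements of infinite order with distinct fixed points. For $g$, $\mathrm{fix}(g)=\{x\in\partial H^n_{\mathbb{C}}: g(x)=x\}$. A subgroup $H$ satisfies Condition A if there is no sequence $\{g_i\}$ of distinct elements of $H$ of finite order with $\mathrm{Card}(\mathrm{fix}(g_i))=\infty$ for all $i$ and $g_i\to I$. *)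

theory Defs
  imports "HOL-Analysis.Analysis"
begin

text \<open>Complex projective model.  Coordinates of C^(n+1) are indexed by
  the type 'n option (None = the distinguished coordinate), so n = CARD('n) \<ge> 1.\<close>

type_synonym 'n cvec = "complex ^ ('n option)"
type_synonym 'n cmat = "complex ^ ('n option) ^ ('n option)"
type_synonym 'n pu = "'n cmat set"      \<comment> \<open>an element of PU(1,n): a class of matrices mod unit scalars\<close>
type_synonym 'n pt = "'n cvec set"      \<comment> \<open>a point of projective space: a complex line minus 0\<close>

definition herm :: "('n::finite) cvec \<Rightarrow> 'n cvec \<Rightarrow> complex" where
  "herm z w = (\<Sum>i\<in>UNIV. (case i of None \<Rightarrow> 1 | Some _ \<Rightarrow> -1) * z $ i * cnj (w $ i))"

definition U1n :: "('n::finite) cmat set" where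
  "U1n = {A. \<forall>z w. herm (A *v z) (A *v w) = herm z w}"

definition cls :: "('n::finite) cmat \<Rightarrow> 'n pu" where
  "cls A = {mat c ** A | c. cmod c = 1}"

definition PU :: "('n::finite) pu set" where
  "PU = cls ` U1n"

definition rep :: "('n::finite) pu \<Rightarrow> 'n cmat" where
  "rep g = (SOME A. A \<in> g)"

definition pu_one :: "('n::finite) pu" where
  "pu_one = cls (mat 1)"

definition pu_mult :: "('n::finite) pu \<Rightarrow> 'n pu \<Rightarrow> 'n pu" where
  "pu_mult g h = cls (rep g ** rep h)"

definition pu_pow :: "('n::finite) pu \<Rightarrow> nat \<Rightarrow> 'n pu" where
  "pu_pow g k = (pu_mult g ^^ k) pu_one"

definition finite_order :: "('n::finite) pu \<Rightarrow> bool" where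
  "finite_order g \<longleftrightarrow> (\<exists>k>0. pu_pow g k = pu_one)"

definition pu_subgroup :: "('n::finite) pu set \<Rightarrow> bool" where
  "pu_subgroup K \<longleftrightarrow> K \<subseteq> PU \<and> pu_one \<in> K \<and> (\<forall>g\<in>K. \<forall>h\<in>K. pu_mult g h \<in> K)
      \<and> (\<forall>g\<in>K. \<exists>h\<in>K. pu_mult g h = pu_one)"

definition gen2 :: "('n::finite) pu \<Rightarrow> 'n pu \<Rightarrow> 'n pu set" where
  "gen2 g h = \<Inter>{K. pu_subgroup K \<and> g \<in> K \<and> h \<in> K}"

definition PU_top :: "('n::finite) pu topology" where
  "PU_top = topology (\<lambda>S. S \<subseteq> PU \<and> openin (top_of_set U1n) (\<Union>S))"

definition pu_discrete :: "('n::finite) pu set \<Rightarrow> bool" where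
  "pu_discrete G \<longleftrightarrow> G \<subseteq> PU \<and> subtopology PU_top G = discrete_topology G"

definition pt :: "('n::finite) cvec \<Rightarrow> 'n pt" where
  "pt z = {c *s z | c. c \<noteq> 0}"

definition hyp :: "('n::finite) pt set" where
  "hyp = {pt z | z. Re (herm z z) > 0}"

definition bdry :: "('n::finite) pt set" where
  "bdry = {pt z | z. z \<noteq> 0 \<and> herm z z = 0}"

definition act :: "('n::finite) pu \<Rightarrow> 'n pt \<Rightarrow> 'n pt" where
  "act g p = (\<lambda>z. rep g *v z) ` p"

definition fixset :: "('n::finite) pu \<Rightarrow> 'n pt set" where
  "fixset g = {x \<in> bdry. act g x = x}"

definition fixcl :: "('n::finite) pu \<Rightarrow> 'n pt set" where
  "fixcl g = {x \<in> hyp \<union> bdry. act g x = x}"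

definition elliptic :: "('n::finite) pu \<Rightarrow> bool" where
  "elliptic g \<longleftrightarrow> g \<in> PU \<and> g \<noteq> pu_one \<and> (\<exists>x\<in>hyp. act g x = x)"

definition parabolic :: "('n::finite) pu \<Rightarrow> bool" where
  "parabolic g \<longleftrightarrow> g \<in> PU \<and> g \<noteq> pu_one \<and> (\<exists>x\<in>bdry. fixcl g = {x})"

definition loxodromic :: "('n::finite) pu \<Rightarrow> bool" where
  "loxodromic g \<longleftrightarrow> g \<in> PU \<and> g \<noteq> pu_one \<and>
     (\<exists>x y. x \<in> bdry \<and> y \<in> bdry \<and> x \<noteq> y \<and> fixcl g = {x, y})"

definition non_elementary :: "('n::finite) pu set \<Rightarrow> bool" where
  "non_elementary G \<longleftrightarrow> (\<exists>g\<in>G. \<exists>h\<in>G. \<not> elliptic g \<and> \<not> elliptic h \<and>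
      \<not> finite_order g \<and> \<not> finite_order h \<and> fixset g \<inter> fixset h = {})"

definition condition_A :: "('n::finite) pu set \<Rightarrow> bool" where
  "condition_A H \<longleftrightarrow> \<not> (\<exists>gs :: nat \<Rightarrow> 'n pu. inj gs \<and>
      (\<forall>i. gs i \<in> H \<and> finite_order (gs i) \<and> infinite (fixset (gs i))) \<and>
      limitin PU_top gs pu_one sequentially)"

definition Gxy :: "('n::finite) pu set \<Rightarrow> 'n pt \<Rightarrow> 'n pt \<Rightarrow> 'n pu set" where
  "Gxy G x y = {f \<in> G. {x, y} \<subseteq> fixset f}"

end

theory Submission
  imports Defs "HOL-Computational_Algebra.Fundamental_Theorem_Algebra"
begin

text \<open>If \<open>G\<close> is not discrete, it contains nontrivial elements \<open>g\<close> arbitrarily close to the identity.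
  For a loxodromic \<open>k\<close> with fixed points \<open>p, q\<close> the group generated by \<open>k\<close> and \<open>g k g\<^sup>-\<^sup>1\<close> is discrete
  and contains the small element \<open>a = k\<^sup>-\<^sup>1 g k g\<^sup>-\<^sup>1\<close>. A Zassenhaus argument (commutators of small elements are
  smaller still) shows that \<open>a\<close>, and hence \<open>g\<close>, fixes \<open>p\<close> and \<open>q\<close>. Applied to \<open>h\<close> and to a conjugate of \<open>h\<close> with
  a third boundary fixed point, this makes \<open>g\<close> act as a unit scalar on the span of \<open>x0\<close> and \<open>y0\<close>,
  so it fixes infinitely many boundary points and its powers stay bounded; as \<open>g\<close> lies in the discrete group
  generated by \<open>h\<close> and \<open>h g\<close>, it has finite order. A sequence of such \<open>g\<close> contradicts Condition A.\<close>

subsection \<open>The Hermitian form and its unitary group\<close>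

text \<open>The group generated by \<open>k\<close> and \<open>g k g^-1\<close> changes with
  \<open>g\<close>, so the Zassenhaus threshold must depend on \<open>k\<close> alone and not on how
  discrete the group is. Hence all estimates use only finitely many powers of \<open>k\<close>, and
  finite dimensionality extends the resulting commutation to every power. A second obstacle is that
  commutation and discreteness in the projective group hold only up to scalars, so the scalar in
  each commutation relation has to be shown to be 1. That \<open>a\<close> fixes \<open>p\<close>
  means that \<open>k\<close> fixes \<open>g^-1 p\<close>, which is therefore \<open>p\<close> or
  \<open>q\<close>; closeness of \<open>g\<close> to the identity rules out an exchange. A third
  fixed point is needed because two of them only give the relation \<open>b * cnj c = 1\<close>
  between the multipliers at \<open>p\<close> and \<open>q\<close>. Finally, Condition A speaks of
  distinct group elements, while different nearby matrices may represent the same one; so each term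
  of the final sequence is chosen closer to the identity than every representative of the term
  before.\<close>

definition sg :: "'a option \<Rightarrow> complex" where
  "sg i = (case i of None \<Rightarrow> 1 | Some _ \<Rightarrow> -1)"

lemma sg_mult_self [simp]: "sg i * sg i = 1"
  by (cases i) (auto simp: sg_def)

lemma sg_mult_self_left [simp]: "sg i * (sg i * x) = x"
  by (simp flip: mult.assoc)

lemma cnj_sg [simp]: "cnj (sg i) = sg i"
  by (cases i) (auto simp: sg_def)

lemma norm_sg [simp]: "cmod (sg i) = 1"
  by (cases i) (auto simp: sg_def)

lemma herm_sg: "herm z w = (\<Sum>i\<in>UNIV. sg i * z $ i * cnj (w $ i))"
  by (simp add: herm_def sg_def)

lemma herm_add_left: "herm (x + y) w = herm x w + herm y w"
  by (simp add: herm_sg algebra_simps sum.distrib)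

lemma herm_add_right: "herm w (x + y) = herm w x + herm w y"
  by (simp add: herm_sg algebra_simps sum.distrib)

lemma herm_scale_left: "herm (c *s x) w = c * herm x w"
  by (simp add: herm_sg sum_distrib_left mult.left_commute mult.assoc)

lemma herm_scale_right: "herm w (c *s x) = cnj c * herm w x"
  by (simp add: herm_sg sum_distrib_left mult_ac)

lemma herm_diff_left: "herm (x - y) w = herm x w - herm y w"
  by (simp add: herm_sg algebra_simps sum_subtractf)

lemma herm_zero_left [simp]: "herm 0 w = 0"
  by (simp add: herm_sg)

lemma herm_zero_right [simp]: "herm w 0 = 0"
  by (simp add: herm_sg)

lemma cnj_herm: "cnj (herm z w) = herm w z"
  by (simp add: herm_sg mult_ac)

lemma herm_eq_0_commute: "herm z w = 0 \<longleftrightarrow> herm w z = 0"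
  using cnj_herm[of z w] by auto

lemmas herm_simps = herm_add_left herm_add_right herm_scale_left herm_scale_right

lemma U1nD: "M \<in> U1n \<Longrightarrow> herm (M *v z) (M *v w) = herm z w"
  by (simp add: U1n_def)

text \<open>The adjoint with respect to \<open>herm\<close>: conjugate transpose, conjugated by the
  signature matrix. On \<open>U1n\<close> it is the inverse, and since it only permutes entries up
  to modulus 1 it has the norm of \<open>M\<close>, so bounds on matrices are at once bounds on
  their inverses.\<close>

definition hinv :: "('n::finite) cmat \<Rightarrow> 'n cmat" where
  "hinv M = (\<chi> i j. sg i * sg j * cnj (M $ j $ i))"

lemma hinv_nth [simp]: "hinv M $ i $ j = sg i * sg j * cnj (M $ j $ i)"
  by (simp add: hinv_def)

lemma hinv_hinv [simp]: "hinv (hinv M) = M"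
  by (simp add: vec_eq_iff hinv_def)

lemma norm_hinv [simp]: "norm (hinv M) = norm M"
proof -
  have "(\<Sum>i\<in>UNIV. \<Sum>j\<in>UNIV. (cmod (M $ j $ i))\<^sup>2) = (\<Sum>i\<in>UNIV. \<Sum>j\<in>UNIV. (cmod (M $ i $ j))\<^sup>2)"
    by (rule sum.swap)
  then show ?thesis
    by (simp add: norm_vec_def L2_set_def sum_nonneg norm_mult power_mult_distrib)
qed

lemma matrix_vector_mul_axis: "(M::'n::finite cmat) *v axis k 1 = (\<chi> i. M $ i $ k)"
  by (simp add: matrix_vector_mult_def vec_eq_iff axis_def if_distrib cong: if_cong)

lemma herm_axis: "herm (axis k 1) (axis j 1) = (if k = j then sg k else 0)"
proof -
  have "herm (axis k 1) (axis j 1) = (\<Sum>i\<in>UNIV. if i = k then (if k = j then sg k else 0) else 0)"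
    unfolding herm_sg by (rule sum.cong) (auto simp: axis_def)
  then show ?thesis by simp
qed

text \<open>The entries of the product are, up to sign, the values of the form on the images of the
  basis vectors.\<close>

lemma hinv_left:
  assumes "M \<in> U1n"
  shows "hinv M ** M = mat 1"
proof -
  have "(hinv M ** M) $ j $ k = mat 1 $ j $ k" for j k
  proof -
    have "herm (M *v axis k 1) (M *v axis j 1) = herm (axis k 1) (axis j 1)"
      using assms by (rule U1nD)
    then have "(\<Sum>i\<in>UNIV. sg i * M $ i $ k * cnj (M $ i $ j)) = (if k = j then sg k else 0)"
      by (simp only: herm_axis) (simp add: matrix_vector_mul_axis herm_sg)
    then have "sg j * (\<Sum>i\<in>UNIV. sg i * M $ i $ k * cnj (M $ i $ j)) = (if j = k then 1 else 0)"
      by auto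
    then show ?thesis
      by (simp add: matrix_matrix_mult_def mat_def sum_distrib_left mult_ac)
  qed
  then show ?thesis by (simp add: vec_eq_iff)
qed

lemma hinv_right:
  assumes "M \<in> U1n"
  shows "M ** hinv M = mat 1"
  using hinv_left[OF assms] matrix_left_right_inverse by blast

lemma hinv_left_vec [simp]: "M \<in> U1n \<Longrightarrow> hinv M *v (M *v x) = x"
  by (simp add: matrix_vector_mul_assoc hinv_left)

lemma hinv_right_vec [simp]: "M \<in> U1n \<Longrightarrow> M *v (hinv M *v x) = x"
  by (simp add: matrix_vector_mul_assoc hinv_right)

lemma hinv_left_mat [simp]: "M \<in> U1n \<Longrightarrow> hinv M ** (M ** X) = X"
  by (simp add: matrix_mul_assoc hinv_left)

lemma hinv_right_mat [simp]: "M \<in> U1n \<Longrightarrow> M ** (hinv M ** X) = X"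
  by (simp add: matrix_mul_assoc hinv_right)

lemma U1n_hinv [simp]: "M \<in> U1n \<Longrightarrow> hinv M \<in> U1n"
  unfolding U1n_def
proof (clarify)
  fix z w :: "'a cvec"
  assume "\<forall>z w. herm (M *v z) (M *v w) = herm z w"
  then have M: "M \<in> U1n" by (simp add: U1n_def)
  show "herm (hinv M *v z) (hinv M *v w) = herm z w"
    using U1nD[OF M, of "hinv M *v z" "hinv M *v w"] M by simp
qed

lemma U1n_mult [simp]: "M \<in> U1n \<Longrightarrow> N \<in> U1n \<Longrightarrow> M ** N \<in> U1n"
  by (simp add: U1n_def flip: matrix_vector_mul_assoc)

lemma U1n_one [simp]: "mat 1 \<in> U1n"
  by (simp add: U1n_def)

lemma mat_vec: "(mat c :: 'n::finite cmat) *v x = c *s x"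
  by (simp add: matrix_vector_mult_def mat_def vec_eq_iff if_distrib if_distribR cong: if_cong)

lemma U1n_scale: "cmod c = 1 \<Longrightarrow> M \<in> U1n \<Longrightarrow> mat c ** M \<in> U1n"
proof -
  assume "cmod c = 1" "M \<in> U1n"
  moreover from this have "c * (cnj c * x) = x" "cnj c * (c * x) = x" for x
    using complex_norm_square[of c] by (simp_all add: mult.commute flip: mult.assoc)
  ultimately show ?thesis
    by (simp add: U1n_def mat_vec herm_simps flip: matrix_vector_mul_assoc)
qed

lemma matvec_scale: "(M::'n::finite cmat) *v (c *s x) = c *s (M *v x)"
  by (simp add: matrix_vector_mult_def vec_eq_iff sum_distrib_left mult_ac)

lemma mat_commute: "mat c ** (M :: 'n::finite cmat) = M ** mat c"
  by (simp add: matrix_eq mat_vec matvec_scale flip: matrix_vector_mul_assoc)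

lemma mat_mult_mat: "(mat c :: 'n::finite cmat) ** mat d = mat (c * d)"
  by (simp add: matrix_eq mat_vec flip: matrix_vector_mul_assoc)

lemma herm_move: "M \<in> U1n \<Longrightarrow> herm (M *v x) y = herm x (hinv M *v y)"
  using U1nD[of M x "hinv M *v y"] by simp

lemma hinv_mult: 
  assumes "M \<in> U1n" "N \<in> U1n" shows "hinv (M ** N) = hinv N ** hinv M"
proof -
  have "hinv (M ** N) ** (M ** N) ** (hinv N ** hinv M) = hinv N ** hinv M"
    using assms by (simp add: hinv_left)
  moreover have "M ** N ** (hinv N ** hinv M) = mat 1"
    using assms by (simp add: hinv_right flip: matrix_mul_assoc)
  ultimately show ?thesis by (simp add: matrix_mul_assoc[symmetric])
qed

lemma hinv_one [simp]: "hinv (mat 1) = mat 1"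
  using hinv_left[of "mat 1"] by simp

section \<open>Norm estimates and definiteness of orthogonal complements\<close>

lemma norm_matvec_bound: "\<exists>C>0. \<forall>(M::'n::finite cmat) x. norm (M *v x) \<le> C * norm M * norm x"
proof -
  have "bounded_bilinear (\<lambda>(M::'n cmat) x. M *v x)"
    by (rule bilinear_conv_bounded_bilinear[THEN iffD1])
      (auto simp: bilinear_def matrix_vector_mult_def vec_eq_iff sum.distrib algebra_simps sum_distrib_left scaleR_sum_right intro!: linearI)
  then obtain C where "C > 0" "\<And>(M::'n cmat) X. norm (M *v X) \<le> C * (norm M * norm X)"
    by (auto dest!: bounded_bilinear.pos_bounded simp: mult.commute mult.left_commute)
  then show ?thesis
    by (intro exI[of _ C]) (auto simp: mult.assoc)
qed

lemma norm_matmat_bound: "\<exists>C>0. \<forall>(M::'n::finite cmat) (N::'n cmat). norm (M ** N) \<le> C * norm M * norm N"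
proof -
  have "bounded_bilinear (\<lambda>(M::'n cmat) (N::'n cmat). M ** N)"
    by (rule bilinear_conv_bounded_bilinear[THEN iffD1])
      (auto simp: bilinear_def matrix_matrix_mult_def vec_eq_iff sum.distrib algebra_simps sum_distrib_left scaleR_sum_right intro!: linearI)
  then obtain C where "C > 0" "\<And>(M::'n cmat) (X::'n cmat). norm (M ** X) \<le> C * (norm M * norm X)"
    by (auto dest!: bounded_bilinear.pos_bounded simp: mult.commute mult.left_commute)
  then show ?thesis
    by (intro exI[of _ C]) (auto simp: mult.assoc)
qed

lemma bounded_linear_matvec: "bounded_linear ((*v) (M::'n::finite cmat))"
  by (rule linear_conv_bounded_linear[THEN iffD1])
    (auto simp: matrix_vector_mult_def vec_eq_iff sum.distrib algebra_simps sum_distrib_left scaleR_sum_right intro!: linearI)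

lemma vec_norm_sq: "(norm (x::'n::finite cvec))\<^sup>2 = (cmod (x $ None))\<^sup>2 + (\<Sum>i\<in>range Some. (cmod (x $ i))\<^sup>2)"
  by (simp add: norm_vec_def L2_set_def sum_nonneg UNIV_option_conv)

lemma herm_split: "herm z w = z $ None * cnj (w $ None) - (\<Sum>i\<in>range Some. z $ i * cnj (w $ i))"
  by (simp add: herm_sg UNIV_option_conv sg_def sum.reindex sum_negf)

lemma herm_split_self: "Re (herm z z) = (cmod (z $ None))\<^sup>2 - (\<Sum>i\<in>range Some. (cmod (z $ i))\<^sup>2)"
  by (simp add: herm_split cmod_power2 flip: power2_eq_square)

text \<open>The signature leaves room for only one positive direction, so the complement of a
  positive vector is negative definite. The explicit constant turns this into control of the
  Euclidean norm by the form, which is how isometries are bounded later.\<close>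

lemma perp_negative:
  fixes s :: "'n::finite cvec"
  assumes "Re (herm s s) > 0"
  shows "\<exists>C>0. \<forall>w. herm w s = 0 \<longrightarrow> (norm w)\<^sup>2 \<le> C * (- Re (herm w w))"
proof -
  define S0 where "S0 = (cmod (s $ None))\<^sup>2"
  define S where "S = (\<Sum>i\<in>range Some. (cmod (s $ i))\<^sup>2)"
  have S: "S \<ge> 0" "S < S0" using assms by (auto simp: S_def S0_def sum_nonneg herm_split_self)
  \<comment> \<open>Read off from \<open>(W0 + W) * (S0 - S) \<le> 2 * S0 * (W - W0)\<close>, which
    Cauchy-Schwarz gives in the form \<open>W0 * S0 \<le> W * S\<close>.\<close>
  define C where "C = 2 * S0 / (S0 - S)"
  have "C > 0" using S by (simp add: C_def)
  moreover have "(norm w)\<^sup>2 \<le> C * (- Re (herm w w))" if "herm w s = 0" for w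
  proof -
    define W0 where "W0 = (cmod (w $ None))\<^sup>2"
    define W where "W = (\<Sum>i\<in>range Some. (cmod (w $ i))\<^sup>2)"
    have W: "W \<ge> 0" by (simp add: W_def sum_nonneg)
    have "w $ None * cnj (s $ None) = (\<Sum>i\<in>range Some. w $ i * cnj (s $ i))"
      using that by (simp add: herm_split)
    then have "cmod (w $ None) * cmod (s $ None) = cmod (\<Sum>i\<in>range Some. w $ i * cnj (s $ i))"
      by (metis complex_mod_cnj norm_mult)
    also have "\<dots> \<le> (\<Sum>i\<in>range Some. \<bar>cmod (w $ i)\<bar> * \<bar>cmod (s $ i)\<bar>)"
      by (rule order_trans[OF norm_sum]) (simp add: norm_mult)
    also have "\<dots> \<le> L2_set (\<lambda>i. cmod (w $ i)) (range Some) * L2_set (\<lambda>i. cmod (s $ i)) (range Some)"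
      by (rule L2_set_mult_ineq)
    finally have "(cmod (w $ None) * cmod (s $ None))\<^sup>2 \<le> (L2_set (\<lambda>i. cmod (w $ i)) (range Some) * L2_set (\<lambda>i. cmod (s $ i)) (range Some))\<^sup>2"
      by (intro power_mono) auto
    moreover have "(L2_set (\<lambda>i. cmod (v $ i)) (range Some))\<^sup>2 = (\<Sum>i\<in>range Some. (cmod (v $ i))\<^sup>2)" for v :: "'n cvec"
      unfolding L2_set_def by (intro real_sqrt_pow2 sum_nonneg zero_le_power2)
    ultimately have 1: "W0 * S0 \<le> W * S"
      unfolding W0_def S0_def W_def S_def power_mult_distrib by metis
    have "W * S \<le> W * S0" using S W by (intro mult_left_mono) auto
    with 1 have "W0 * S0 \<le> W * S0" by linarith
    moreover have "S0 > 0" using S by linarith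
    ultimately have "W0 \<le> W" by (rule mult_right_le_imp_le)
    have "(W0 + W) * (S0 - S) \<le> 2 * W * (S0 - S)"
      using \<open>W0 \<le> W\<close> S by (intro mult_right_mono) auto
    also have "\<dots> \<le> 2 * S0 * (W - W0)"
      using 1 by (simp add: algebra_simps)
    finally have "(W0 + W) \<le> C * (W - W0)"
      using S by (simp add: C_def pos_le_divide_eq)
    then show ?thesis
      by (simp add: vec_norm_sq herm_split_self W_def W0_def)
  qed
  ultimately show ?thesis by blast
qed

lemma cmod_eq_1:
  assumes "c * cnj c = 1"
  shows "cmod c = 1"
proof -
  have "(cmod c)\<^sup>2 = 1" using norm_mult[of c "cnj c"] assms by (simp add: power2_eq_square)
  then have "cmod c = 1 \<or> cmod c = -1" by (simp only: power2_eq_1_iff)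
  then show ?thesis using norm_ge_zero[of c] by linarith
qed

subsection \<open>Loxodromic matrices and discrete groups\<close>

lemma norm_herm_le: "cmod (herm z w) \<le> norm z * norm w"
proof -
  have "cmod (herm z w) \<le> (\<Sum>i\<in>UNIV. \<bar>cmod (z $ i)\<bar> * \<bar>cmod (w $ i)\<bar>)"
    unfolding herm_sg by (rule order_trans[OF norm_sum]) (simp add: norm_mult)
  also have "\<dots> \<le> norm z * norm w"
    unfolding norm_vec_def by (rule L2_set_mult_ineq)
  finally show ?thesis .
qed

lemma norm_scale [simp]: "norm (c *s (x::'n::finite cvec)) = cmod c * norm x"
  by (simp add: norm_vec_def norm_mult L2_set_right_distrib)

text \<open>Mostly used contrapositively: eigenvectors whose eigenvalues violate the relation are
  orthogonal. With \<open>u = v\<close> it says that an eigenvalue off the unit circle has only null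
  eigenvectors.\<close>

lemma eigenvalues_reciprocal:
  assumes "M \<in> U1n" "M *v v = a *s v" "M *v u = b *s u" "herm v u \<noteq> 0"
  shows "a * cnj b = 1"
  using U1nD[OF assms(1), of v u] assms(2-4) by (simp add: herm_simps mult.commute[of a])

lemma hinv_eigen:
  assumes "M \<in> U1n" "M *v v = a *s v" "v \<noteq> 0"
  shows "a \<noteq> 0" "hinv M *v v = inverse a *s v"
proof -
  have v: "v = a *s (hinv M *v v)"
    using hinv_left_vec[OF assms(1), of v] assms(2) by (simp add: matvec_scale)
  then show a: "a \<noteq> 0" using assms(3) by auto
  have "inverse a *s v = inverse a *s (a *s (hinv M *v v))" using v by simp
  then show "hinv M *v v = inverse a *s v" using a by (simp add: vector_smult_assoc)
qed

section \<open>Powers, matrix groups and discreteness modulo scalars\<close>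

primrec mpow :: "('n::finite) cmat \<Rightarrow> nat \<Rightarrow> 'n cmat" where
  "mpow A 0 = mat 1"
| "mpow A (Suc j) = A ** mpow A j"

lemma mpow_U1n [simp]: "A \<in> U1n \<Longrightarrow> mpow A j \<in> U1n"
  by (induction j) auto

lemma mpow_eigen: "A *v v = a *s v \<Longrightarrow> mpow A j *v v = (a ^ j) *s v"
proof (induction j)
  case (Suc j)
  then show ?case
    by (simp add: matrix_vector_mul_assoc[symmetric] matvec_scale mult.commute)
qed auto

lemma mpow_add: "mpow A (i + j) = mpow A i ** mpow A j"
  by (induction i) (auto simp: matrix_mul_assoc)

lemma mpow_Suc2: "mpow A (Suc j) = mpow A j ** A"
  using mpow_add[of A j 1] by simp

lemma hinv_mpow: "A \<in> U1n \<Longrightarrow> hinv (mpow A j) = mpow (hinv A) j"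
proof (induction j)
  case (Suc j)
  then show ?case
    using mpow_Suc2[of "hinv A" j] by (simp add: hinv_mult)
qed auto

definition mgroup :: "('n::finite) cmat set \<Rightarrow> bool" where
  "mgroup \<Gamma> \<longleftrightarrow> \<Gamma> \<subseteq> U1n \<and> mat 1 \<in> \<Gamma> \<and> (\<forall>M\<in>\<Gamma>. \<forall>N\<in>\<Gamma>. M ** N \<in> \<Gamma>) \<and> (\<forall>M\<in>\<Gamma>. hinv M \<in> \<Gamma>)"

text \<open>Discreteness modulo scalars: the groups considered contain every unit scalar matrix.\<close>

definition mdiscrete :: "('n::finite) cmat set \<Rightarrow> bool" where
  "mdiscrete \<Gamma> \<longleftrightarrow> (\<exists>e>0. \<forall>M\<in>\<Gamma>. norm (M - mat 1) < e \<longrightarrow> (\<exists>c. M = mat c))"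

lemma mgroupD:
  assumes "mgroup \<Gamma>"
  shows "M \<in> \<Gamma> \<Longrightarrow> M \<in> U1n" "mat 1 \<in> \<Gamma>" "M \<in> \<Gamma> \<Longrightarrow> N \<in> \<Gamma> \<Longrightarrow> M ** N \<in> \<Gamma>" "M \<in> \<Gamma> \<Longrightarrow> hinv M \<in> \<Gamma>"
  using assms by (auto simp: mgroup_def)

lemma mgroup_mpow: "mgroup \<Gamma> \<Longrightarrow> M \<in> \<Gamma> \<Longrightarrow> mpow M j \<in> \<Gamma>"
  by (induction j) (auto simp: mgroupD)

lemma matrix_diff_distrib_left: "(X::'n::finite cmat) ** (Y - Z) = X ** Y - X ** (Z :: 'n cmat)"
  by (simp add: matrix_matrix_mult_def vec_eq_iff algebra_simps sum_subtractf)

lemma matrix_diff_distrib_right: "(Y - Z) ** (X::'n::finite cmat) = Y ** X - (Z :: 'n cmat) ** X"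
  by (simp add: matrix_matrix_mult_def vec_eq_iff algebra_simps sum_subtractf)

text \<open>Two late terms of a convergent subsequence have a quotient near the identity, and
  discreteness makes that quotient scalar. The inverse of \<open>M i\<close> needs no separate
  bound, since \<open>hinv\<close> preserves the norm.\<close>

lemma discrete_bounded_repeat:
  fixes M :: "nat \<Rightarrow> ('n::finite) cmat"
  assumes "mgroup \<Gamma>" "mdiscrete \<Gamma>" "\<And>j. M j \<in> \<Gamma>" "\<And>j. norm (M j) \<le> K"
  shows "\<exists>i j c. i < j \<and> M j = mat c ** M i"
proof -
  obtain e where e: "e > 0" "\<And>N. N \<in> \<Gamma> \<Longrightarrow> norm (N - mat 1) < e \<Longrightarrow> \<exists>c. N = mat c"
    using assms(2) by (auto simp: mdiscrete_def)
  obtain C where C: "C > 0" "\<And>(X::'n cmat) (Y::'n cmat). norm (X ** Y) \<le> C * norm X * norm Y"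
    using norm_matmat_bound by blast
  have "K \<ge> 0" using assms(4)[of 0] norm_ge_zero order_trans by blast
  have "\<And>j. M j \<in> cball 0 K" using assms(4) by simp
  then obtain L r where r: "strict_mono r" "(M \<circ> r) \<longlonglongrightarrow> L"
    using compact_cball[of "0::'n cmat" K, unfolded compact_def] by metis
  \<comment> \<open>The summand 1 covers \<open>K = 0\<close> and makes \<open>C * K * d < e\<close>
    strict.\<close>
  define d where "d = e / (C * K + 1)"
  have CK: "C * K + 1 > 0" using C \<open>K \<ge> 0\<close> by (simp add: add_nonneg_pos)
  then have "d > 0" using e by (simp add: d_def)
  then obtain N where N: "\<And>i j. i \<ge> N \<Longrightarrow> j \<ge> N \<Longrightarrow> dist ((M \<circ> r) i) ((M \<circ> r) j) < d"
    using LIMSEQ_imp_Cauchy[OF r(2)] unfolding Cauchy_def by metis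
  define i where "i = r N"
  define j where "j = r (Suc N)"
  have "i < j" using r(1) by (simp add: i_def j_def strict_mono_def)
  have d: "norm (M j - M i) < d" using N[of "Suc N" N] by (simp add: i_def j_def dist_norm)
  have U: "M i \<in> U1n" "M j \<in> U1n" using assms mgroupD by blast+
  have "norm (hinv (M i) ** M j - mat 1) = norm (hinv (M i) ** (M j - M i))"
    using U by (simp add: matrix_diff_distrib_left hinv_left)
  also have "\<dots> \<le> C * norm (M i) * norm (M j - M i)"
    using C(2)[of "hinv (M i)"] by simp
  also have "\<dots> \<le> C * K * d"
    using assms(4) C \<open>K \<ge> 0\<close> d \<open>d > 0\<close> by (intro mult_mono) auto
  also have "\<dots> < e"
    using CK e by (simp add: d_def field_simps)
  finally obtain c where "hinv (M i) ** M j = mat c"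
    using e(2) assms mgroupD by meson
  then have "M i ** (hinv (M i) ** M j) = mat c ** M i"
    by (simp add: mat_commute)
  then have "M j = mat c ** M i" using U by simp
  then show ?thesis using \<open>i < j\<close> by blast
qed

text \<open>Boundedness on the finitely many basis vectors bounds every column, hence every
  entry.\<close>

lemma bounded_of_pointwise:
  fixes M :: "nat \<Rightarrow> ('n::finite) cmat"
  assumes "\<And>v. \<exists>K. \<forall>j. norm (M j *v v) \<le> K"
  shows "\<exists>K. \<forall>j. norm (M j) \<le> K"
proof -
  have "\<forall>k. \<exists>K. \<forall>j. norm (M j *v axis k 1) \<le> K"
    using assms by blast
  then obtain K where K: "\<And>k j. norm (M j *v axis k 1) \<le> K k"
    by metis
  have "norm (M j) \<le> (\<Sum>i\<in>(UNIV::'n option set). \<Sum>k\<in>UNIV. K k)" for j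
  proof -
    have "norm (M j) \<le> (\<Sum>i\<in>UNIV. norm (M j $ i))"
      unfolding norm_vec_def by (rule L2_set_le_sum) auto
    also have "\<dots> \<le> (\<Sum>i\<in>(UNIV::'n option set). \<Sum>k\<in>UNIV. K k)"
    proof (rule sum_mono)
      fix i :: "'n option"
      have "norm (M j $ i) \<le> (\<Sum>k\<in>UNIV. norm (M j $ i $ k))"
        unfolding norm_vec_def[of "M j $ i"] by (rule L2_set_le_sum) auto
      also have "\<dots> \<le> (\<Sum>k\<in>UNIV. K k)"
      proof (rule sum_mono)
        fix k
        have "norm (M j $ i $ k) = norm ((M j *v axis k 1) $ i)"
          by (simp add: matrix_vector_mul_axis)
        also have "\<dots> \<le> K k" using K Finite_Cartesian_Product.norm_nth_le order_trans by blast
        finally show "norm (M j $ i $ k) \<le> K k" .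
      qed
      finally show "norm (M j $ i) \<le> (\<Sum>k\<in>UNIV. K k)" .
    qed
    finally show ?thesis .
  qed
  then show ?thesis by blast
qed

text \<open>Representatives of two distinct boundary points. Their span has signature (1,1), so its
  orthogonal complement is negative definite.\<close>

locale null_pair =
  fixes p q :: "('n::finite) cvec"
  assumes null_p [simp]: "herm p p = 0" and null_q [simp]: "herm q q = 0"
    and herm_pq [simp]: "herm p q \<noteq> 0"
begin

lemma herm_qp [simp]: "herm q p \<noteq> 0"
  using herm_pq herm_eq_0_commute by blast

lemma p_nz [simp]: "p \<noteq> 0" and q_nz [simp]: "q \<noteq> 0"
  using herm_pq herm_zero_left herm_zero_right by blast+

lemma swapped: "null_pair q p"
  by unfold_locales auto

lemma decomp:
  obtains a b w where "v = a *s p + b *s q + w" "herm w p = 0" "herm w q = 0"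
proof
  show "v = (herm v q / herm p q) *s p + (herm v p / herm q p) *s q
     + (v - (herm v q / herm p q) *s p - (herm v p / herm q p) *s q)"
    by simp
qed (simp_all add: herm_diff_left herm_simps)

lemma perp_bound:
  obtains C where "C > 0" "\<And>w. herm w p = 0 \<Longrightarrow> herm w q = 0 \<Longrightarrow> (norm w)\<^sup>2 \<le> C * (- Re (herm w w))"
proof -
  \<comment> \<open>The coefficient aligns phases, so that \<open>herm s s\<close> is twice the
    squared modulus of \<open>herm p q\<close>; a vector orthogonal to \<open>p\<close> and
    \<open>q\<close> is orthogonal to \<open>s\<close>.\<close>
  define s where "s = p + herm p q *s q"
  have "herm s s = cnj (herm p q) * herm p q + herm p q * cnj (herm p q)"
    by (simp add: s_def herm_simps cnj_herm)
  then have "Re (herm s s) > 0"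
    by (simp add: complex_norm_square[symmetric] mult.commute)
  then obtain C where "C > 0" "\<forall>w. herm w s = 0 \<longrightarrow> (norm w)\<^sup>2 \<le> C * (- Re (herm w w))"
    using perp_negative by blast
  then show ?thesis
    by (intro that[of C]) (auto simp: s_def herm_simps)
qed

lemma perp_nonneg_zero:
  assumes "herm w p = 0" "herm w q = 0" "Re (herm w w) \<ge> 0"
  shows "w = 0"
proof -
  obtain C where "C > 0" "(norm w)\<^sup>2 \<le> C * (- Re (herm w w))" using perp_bound assms by metis
  then have "(norm w)\<^sup>2 \<le> 0"
    using assms(3) by (smt (verit) mult_nonneg_nonpos)
  then show ?thesis by simp
qed

text \<open>Totally isotropic subspaces are at most one-dimensional: orthogonality to
  \<open>p\<close> kills the \<open>q\<close>-component, and the remaining part in the negative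
  definite complement is null, hence zero.\<close>

lemma null_perp:
  assumes "herm v v = 0" "herm v p = 0"
  shows "\<exists>c. v = c *s p"
proof -
  obtain a b w where v: "v = a *s p + b *s q + w" "herm w p = 0" "herm w q = 0"
    by (rule decomp)
  have "b = 0" using assms(2) by (simp add: v herm_simps)
  moreover have "herm p w = 0" using v herm_eq_0_commute by blast
  ultimately have "herm w w = 0" using assms(1) v by (simp add: herm_simps)
  then have "w = 0" using v perp_nonneg_zero by simp
  then show ?thesis using v \<open>b = 0\<close> by auto
qed

end

text \<open>Normal form of a loxodromic element: \<open>cmod l > 1\<close> makes \<open>p\<close>
  the attracting and \<open>q\<close> the repelling fixed point. The inverse exchanges the two, so
  every fact about \<open>p\<close> has a counterpart for \<open>q\<close>.\<close>

locale lox = null_pair p q for p q :: "('n::finite) cvec" +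
  fixes A :: "'n cmat" and l m :: complex
  assumes A_U [simp]: "A \<in> U1n" and A_p: "A *v p = l *s p" and A_q: "A *v q = m *s q"
    and l_gt: "cmod l > 1"
begin

lemma lm: "l * cnj m = 1"
  using eigenvalues_reciprocal[OF A_U A_p A_q] by simp

lemma l_nz [simp]: "l \<noteq> 0" and m_nz [simp]: "m \<noteq> 0"
  using lm by auto

lemma cmod_m: "cmod m = inverse (cmod l)"
  using arg_cong[OF lm, of cmod] by (simp add: norm_mult inverse_eq_divide nonzero_eq_divide_eq mult.commute)

lemma inv_lox: "lox q p (hinv A) (inverse m) (inverse l)"
  using hinv_eigen[OF A_U A_p] hinv_eigen[OF A_U A_q] l_gt
  by unfold_locales (auto simp: norm_inverse cmod_m)

lemma power_lox: "j > 0 \<Longrightarrow> lox p q (mpow A j) (l ^ j) (m ^ j)"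
  using A_p A_q l_gt by unfold_locales (auto simp: mpow_eigen norm_power one_less_power)

text \<open>A vector not orthogonal to \<open>q\<close> shares the eigenvalue \<open>l\<close> with
  \<open>p\<close>; as \<open>l\<close> is off the unit circle, the vector is null and orthogonal to
  \<open>p\<close>, so it lies on the line of \<open>p\<close>. Symmetrically for \<open>q\<close>.
  A vector orthogonal to both is zero by definiteness, which the first alternative absorbs with
  \<open>c = 0\<close>.\<close>

lemma eigen_cases:
  assumes "A *v v = a *s v" "Re (herm v v) \<ge> 0"
  obtains c where "v = c *s p" | c where "v = c *s q"
proof -
  have nl: "l * cnj l \<noteq> 1" "m * cnj m \<noteq> 1"
  proof -
    show "l * cnj l \<noteq> 1" using l_gt
      by (metis complex_mod_cnj less_1_mult norm_mult norm_one order_less_irrefl)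
    show "m * cnj m \<noteq> 1"
    proof
      assume "m * cnj m = 1"
      then have "cmod m * cmod m = 1" using norm_mult[of m "cnj m"] by simp
      then show False using l_gt by (simp add: cmod_m field_simps) (smt (verit) less_1_mult)
    qed
  qed
  consider "herm v q \<noteq> 0" | "herm v p \<noteq> 0" | "herm v p = 0" "herm v q = 0" by blast
  then show ?thesis
  proof cases
    case 1
    have "a * cnj m = 1" using eigenvalues_reciprocal[OF A_U assms(1) A_q 1] .
    then have "a = l" using lm by (metis m_nz complex_cnj_zero_iff mult_cancel_right)
    have "herm v p = 0"
      using eigenvalues_reciprocal[OF A_U assms(1) A_p] nl \<open>a = l\<close> by blast
    moreover have "herm v v = 0"
      using eigenvalues_reciprocal[OF A_U assms(1) assms(1)] nl \<open>a = l\<close> by blast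
    ultimately show ?thesis using null_perp that by blast
  next
    case 2
    have "a * cnj l = 1" using eigenvalues_reciprocal[OF A_U assms(1) A_p 2] .
    moreover have "m * cnj l = 1" using arg_cong[OF lm, of cnj] by (simp add: mult.commute)
    ultimately have "a = m" by (metis l_nz complex_cnj_zero_iff mult_cancel_right)
    have "herm v q = 0"
      using eigenvalues_reciprocal[OF A_U assms(1) A_q] nl \<open>a = m\<close> by blast
    moreover have "herm v v = 0"
      using eigenvalues_reciprocal[OF A_U assms(1) assms(1)] nl \<open>a = m\<close> by blast
    ultimately show ?thesis using null_pair.null_perp[OF swapped] that by blast
  next
    case 3
    then have "v = 0 *s p" using perp_nonneg_zero assms by simp
    then show ?thesis using that by blast
  qed
qed

lemma eigen_m:
  assumes "A *v v = m *s v"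
  shows "\<exists>c. v = c *s q"
proof (cases "v = 0")
  case False
  have nl: "m * cnj m \<noteq> 1"
  proof
    assume "m * cnj m = 1"
    then have "cmod m * cmod m = 1" using norm_mult[of m "cnj m"] by simp
    then show False using l_gt by (simp add: cmod_m field_simps) (smt (verit) less_1_mult)
  qed
  have "herm v v = 0" using eigenvalues_reciprocal[OF A_U assms assms] nl by blast
  moreover have "herm v q = 0" using eigenvalues_reciprocal[OF A_U assms A_q] nl by blast
  ultimately show ?thesis using null_pair.null_perp[OF swapped] by blast
qed (auto intro: exI[of _ 0])

text \<open>Negative powers of \<open>A\<close> expand only the direction \<open>q\<close>, and
  orthogonality to \<open>p\<close> excludes a \<open>q\<close>-component. They shrink
  \<open>p\<close> and act isometrically for the definite form on the complement.\<close>

lemma inv_power_bound: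
  obtains K where "K > 0" "\<And>j y. herm y p = 0 \<Longrightarrow> norm (hinv (mpow A j) *v y) \<le> K * norm y"
proof -
  obtain C where C: "C > 0" "\<And>w. herm w p = 0 \<Longrightarrow> herm w q = 0 \<Longrightarrow> (norm w)\<^sup>2 \<le> C * (- Re (herm w w))"
    using perp_bound by blast
  define c1 where "c1 = norm q / cmod (herm p q)"
  define K where "K = c1 * norm p + sqrt C * (1 + c1 * norm p)"
  have c1: "c1 > 0" by (simp add: c1_def)
  have "K > 0" using C c1 by (auto simp: K_def intro!: add_pos_nonneg)
  moreover have "norm (hinv (mpow A j) *v y) \<le> K * norm y" if y: "herm y p = 0" for j y
  proof -
    let ?P = "mpow A j"
    define a where "a = herm y q / herm p q"
    define w where "w = y - a *s p"
    have w: "herm w p = 0" "herm w q = 0"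
      using y by (simp_all add: w_def a_def herm_diff_left herm_simps)
    have a: "cmod a \<le> c1 * norm y"
      using norm_herm_le[of y q] by (simp add: a_def c1_def norm_divide divide_right_mono mult.commute)
    have Pp: "?P *v p = l ^ j *s p" "?P *v q = m ^ j *s q"
      using mpow_eigen A_p A_q by auto
    have hP: "hinv ?P *v p = inverse (l ^ j) *s p"
      using hinv_eigen(2)[OF _ Pp(1)] by simp
    have "norm w \<le> norm y + norm (a *s p)" unfolding w_def by (rule norm_triangle_ineq4)
    also have "\<dots> \<le> norm y + c1 * norm y * norm p"
      using a by (simp add: mult_right_mono)
    finally have nw: "norm w \<le> (1 + c1 * norm p) * norm y" by (simp add: algebra_simps)
    let ?w = "hinv ?P *v w"
    have "herm ?w p = 0" "herm ?w q = 0"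
      using w Pp by (simp_all add: herm_move herm_simps)
    moreover have "herm ?w ?w = herm w w" by (simp add: U1nD)
    ultimately have "(norm ?w)\<^sup>2 \<le> C * (- Re (herm w w))" using C(2)[of ?w] by simp
    also have "\<dots> \<le> C * (norm w)\<^sup>2"
      using norm_herm_le[of w w] abs_Re_le_cmod[of "herm w w"] C
      by (intro mult_left_mono) (auto simp: power2_eq_square)
    finally have "norm ?w \<le> sqrt (C * (norm w)\<^sup>2)" by (rule real_le_rsqrt)
    also have "\<dots> = sqrt C * norm w" by (simp add: real_sqrt_mult)
    also have "\<dots> \<le> sqrt C * ((1 + c1 * norm p) * norm y)"
      using nw C by (intro mult_left_mono) auto
    finally have nhw: "norm ?w \<le> sqrt C * ((1 + c1 * norm p) * norm y)" .
    have "cmod (inverse (l ^ j)) \<le> 1"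
      using l_gt by (simp add: norm_inverse norm_power inverse_le_1_iff one_le_power)
    then have "cmod a * cmod (inverse (l ^ j)) \<le> c1 * norm y * 1"
      using a c1 by (intro mult_mono) auto
    then have "norm (a *s (hinv ?P *v p)) \<le> c1 * norm y * norm p"
      by (simp add: hP mult_right_mono norm_mult flip: mult.assoc)
    moreover have "hinv ?P *v y = a *s (hinv ?P *v p) + ?w"
      by (simp add: w_def matrix_vector_mult_diff_distrib matvec_scale)
    ultimately have "norm (hinv ?P *v y) \<le> c1 * norm y * norm p + sqrt C * ((1 + c1 * norm p) * norm y)"
      using nhw by (simp only: norm_triangle_mono)
    then show ?thesis by (simp add: K_def algebra_simps)
  qed
  ultimately show ?thesis using that by blast
qed

lemma power_bound:
  obtains K where "K > 0" "\<And>j y. herm y q = 0 \<Longrightarrow> norm (mpow A j *v y) \<le> K * norm y"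
proof -
  obtain K where "K > 0" "\<And>j y. herm y q = 0 \<Longrightarrow> norm (hinv (mpow (hinv A) j) *v y) \<le> K * norm y"
    using lox.inv_power_bound[OF inv_lox] by metis
  then show ?thesis by (intro that[of K]) (auto simp: hinv_mpow)
qed

text \<open>The direction \<open>p\<close> only picks up the multiplier \<open>a\<close>. On
  \<open>q\<close> the factor \<open>m ^ j\<close> offsets the return by the inverse power, up to a
  part orthogonal to \<open>p\<close>. On the complement \<open>z\<close> preserves orthogonality to
  \<open>p\<close>, where inverse powers are uniformly bounded.\<close>

lemma conjugates_bounded:
  assumes z: "z \<in> U1n" "z *v p = a *s p"
  shows "\<exists>K. \<forall>j. norm (hinv (mpow A j) ** z ** mpow A j) \<le> K"
proof (rule bounded_of_pointwise)
  let ?M = "\<lambda>j. hinv (mpow A j) ** z ** mpow A j"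
  fix v :: "'n cvec"
  obtain K where K: "K > 0" "\<And>j y. herm y p = 0 \<Longrightarrow> norm (hinv (mpow A j) *v y) \<le> K * norm y"
    using inv_power_bound by blast
  obtain K' where K': "K' > 0" "\<And>j y. herm y q = 0 \<Longrightarrow> norm (mpow A j *v y) \<le> K' * norm y"
    using power_bound by blast
  obtain C where C: "C > 0" "\<And>M x. norm ((M::'n cmat) *v x) \<le> C * norm M * norm x"
    using norm_matvec_bound by blast
  have a: "a \<noteq> 0" using hinv_eigen[OF z] by simp
  have M: "?M j *v x = hinv (mpow A j) *v (z *v (mpow A j *v x))" for j x
    by (simp add: matrix_vector_mul_assoc matrix_mul_assoc)
  have Pp: "mpow A j *v p = l ^ j *s p" "mpow A j *v q = m ^ j *s q" for j
    using mpow_eigen A_p A_q by auto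
  have hP: "hinv (mpow A j) *v p = inverse (l ^ j) *s p" "hinv (mpow A j) *v q = inverse (m ^ j) *s q" for j
    using hinv_eigen(2)[OF _ Pp(1)] hinv_eigen(2)[OF _ Pp(2)] by simp_all
  obtain s t w where v: "v = s *s p + t *s q + w" and w: "herm w p = 0" "herm w q = 0"
    by (rule decomp)
  have 1: "norm (?M j *v p) \<le> norm (a *s p)" for j
    using l_nz by (simp add: M Pp matvec_scale z hP norm_inverse norm_mult norm_power mult_ac)
  define b where "b = herm (z *v q) p / herm q p"
  define y where "y = z *v q - b *s q"
  have y: "herm y p = 0" by (simp add: y_def b_def herm_diff_left herm_simps)
  have 2: "norm (?M j *v q) \<le> norm (b *s q) + K * norm y" for j
  proof -
    have "z *v q = b *s q + y" by (simp add: y_def)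
    then have "?M j *v q = b *s q + m ^ j *s (hinv (mpow A j) *v y)"
      by (simp add: M Pp matvec_scale hP matrix_vector_right_distrib vector_add_ldistrib vector_smult_assoc)
    moreover have "cmod (m ^ j) \<le> 1"
      using l_gt by (simp add: cmod_m norm_power power_le_one inverse_le_1_iff)
    then have "norm (m ^ j *s (hinv (mpow A j) *v y)) \<le> 1 * (K * norm y)"
      unfolding norm_scale using K(2)[OF y] K(1) by (intro mult_mono) auto
    ultimately show ?thesis by (metis mult_1 norm_triangle_mono order_refl)
  qed
  have 3: "norm (?M j *v w) \<le> K * (C * norm z * (K' * norm w))" for j
  proof -
    have "herm (mpow A j *v w) p = 0"
      using w hP by (simp add: herm_move herm_simps)
    then have "herm (z *v (mpow A j *v w)) p = 0"
      using hinv_eigen(2)[OF z] by (simp add: herm_move z herm_simps)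
    then have "norm (?M j *v w) \<le> K * norm (z *v (mpow A j *v w))"
      using K(2) by (simp add: M)
    also have "norm (z *v (mpow A j *v w)) \<le> C * norm z * norm (mpow A j *v w)"
      by (rule C(2))
    also have "\<dots> \<le> C * norm z * (K' * norm w)"
      using K'(2)[OF w(2), of j] C(1) by (intro mult_left_mono) auto
    finally show ?thesis using K(1) by simp
  qed
  have "norm (?M j *v v) \<le> cmod s * norm (a *s p) + cmod t * (norm (b *s q) + K * norm y) + K * (C * norm z * (K' * norm w))" for j
  proof -
    have "norm (?M j *v v) \<le> norm (s *s (?M j *v p)) + norm (t *s (?M j *v q)) + norm (?M j *v w)"
      unfolding v matrix_vector_right_distrib matvec_scale
      by (intro norm_triangle_le add_mono norm_triangle_ineq order_refl)
    also have "\<dots> \<le> cmod s * norm (a *s p) + cmod t * (norm (b *s q) + K * norm y) + K * (C * norm z * (K' * norm w))"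
      unfolding norm_scale[of s "?M j *v p"] norm_scale[of t "?M j *v q"]
      by (intro add_mono mult_left_mono 1 2 3 norm_ge_zero)
    finally show ?thesis .
  qed
  then show "\<exists>K. \<forall>j. norm (?M j *v v) \<le> K" by blast
qed

text \<open>The classical fact that in a discrete group a loxodromic element cannot share exactly
  one fixed point with another element. Two of the bounded conjugates agree up to a scalar, so
  \<open>z\<close> commutes with a power of \<open>A\<close> up to that scalar. Evaluation at
  \<open>p\<close> shows that it is 1, and then \<open>z *v q\<close> is an eigenvector of this
  power for the multiplier of \<open>q\<close>.\<close>

lemma shared_fixed_point:
  assumes "mgroup \<Gamma>" "mdiscrete \<Gamma>" "A \<in> \<Gamma>" "z \<in> \<Gamma>" "z *v p = a *s p"
  shows "\<exists>b. z *v q = b *s q"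
proof -
  let ?M = "\<lambda>j. hinv (mpow A j) ** z ** mpow A j"
  have z: "z \<in> U1n" using assms mgroupD by blast
  obtain K where "\<And>j. norm (?M j) \<le> K"
    using conjugates_bounded[OF z assms(5)] by blast
  moreover have "?M j \<in> \<Gamma>" for j
    using assms by (simp add: mgroupD mgroup_mpow)
  ultimately obtain i j c where ij: "i < j" "?M j = mat c ** ?M i"
    using discrete_bounded_repeat[OF assms(1,2), of ?M K] by blast
  define r where "r = j - i"
  have r: "r > 0" "j = r + i" using ij by (auto simp: r_def)
  let ?P = "mpow A r"
  have "?M j = hinv (mpow A i) ** (hinv ?P ** z ** ?P) ** mpow A i"
    by (simp add: r mpow_add hinv_mult matrix_mul_assoc)
  then have conj: "mpow A i ** ?M j ** hinv (mpow A i) = hinv ?P ** z ** ?P"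
    by (simp add: hinv_right flip: matrix_mul_assoc)
  have "mpow A i ** ?M j ** hinv (mpow A i) = mpow A i ** mat c ** hinv (mpow A i) ** z"
    unfolding ij(2) by (simp add: hinv_right flip: matrix_mul_assoc)
  moreover have "mpow A i ** mat c ** hinv (mpow A i) = mat c ** (mpow A i ** hinv (mpow A i))"
    by (metis mat_commute matrix_mul_assoc)
  ultimately have "mpow A i ** ?M j ** hinv (mpow A i) = mat c ** z"
    by (simp add: hinv_right)
  with conj have "?P ** (hinv ?P ** z ** ?P) = ?P ** (mat c ** z)" by simp
  then have zP: "z ** ?P = mat c ** (?P ** z)"
    by (simp add: mat_commute flip: matrix_mul_assoc)
  have zPv: "z *v (?P *v v) = c *s (?P *v (z *v v))" for v
    using arg_cong[OF zP, of "\<lambda>X. X *v v"] by (simp add: mat_vec flip: matrix_vector_mul_assoc)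
  have Pp: "?P *v p = l ^ r *s p" "?P *v q = m ^ r *s q"
    using mpow_eigen A_p A_q by auto
  have "a \<noteq> 0" using hinv_eigen[OF z assms(5)] by simp
  have "(l ^ r * a) *s p = (c * (l ^ r * a)) *s p"
    using zPv[of p] by (simp add: Pp assms(5) matvec_scale vector_smult_assoc mult_ac)
  then have "(l ^ r * a - c * (l ^ r * a)) *s p = 0"
    by (simp add: vector_sub_rdistrib)
  then have "c = 1" using \<open>a \<noteq> 0\<close> by simp
  then have "?P *v (z *v q) = m ^ r *s (z *v q)"
    using zPv[of q] by (simp add: Pp matvec_scale)
  then show ?thesis
    using lox.eigen_m[OF power_lox[OF r(1)]] by blast
qed

end

subsection \<open>Joint eigenvectors\<close>

text \<open>The first iterate that depends on its predecessors occurs by index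
  \<open>DIM('a)\<close>, and from there on the span is invariant. It serves twice: to find an
  annihilating polynomial, and to reduce infinitely many conjugates of a matrix to finitely
  many.\<close>

lemma cyclic_span:
  fixes T :: "'a::euclidean_space \<Rightarrow> 'a"
  assumes "linear T"
  shows "(T ^^ m) x \<in> span ((\<lambda>j. (T ^^ j) x) ` {..<DIM('a)})"
proof -
  define S where "S N = span ((\<lambda>j. (T ^^ j) x) ` {..<N})" for N
  have S_Suc: "dim (S (Suc N)) = (if (T ^^ N) x \<in> S N then dim (S N) else dim (S N) + 1)" for N
    by (simp add: S_def lessThan_Suc dim_insert)
  have S_mono: "S N \<subseteq> S N'" if "N \<le> N'" for N N'
    using that unfolding S_def by (intro span_mono image_mono) auto
  have "\<exists>N\<le>DIM('a). (T ^^ N) x \<in> S N"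
  proof (rule ccontr)
    assume *: "\<not> ?thesis"
    have "dim (S N) = N" if "N \<le> Suc DIM('a)" for N
      using that
    proof (induction N)
      case (Suc N)
      then show ?case using * S_Suc[of N] by auto
    qed (simp add: S_def)
    from this[of "Suc DIM('a)"] show False
      using dim_subset_UNIV[of "S (Suc DIM('a))"] by simp
  qed
  then obtain N where N: "N \<le> DIM('a)" "(T ^^ N) x \<in> S N" by blast
  have T: "T y \<in> S N" if "y \<in> S N" for y
  proof -
    have "T ` S N = span (T ` ((\<lambda>j. (T ^^ j) x) ` {..<N}))"
      unfolding S_def by (rule linear_span_image[OF assms, symmetric])
    also have "\<dots> \<subseteq> S N"
      unfolding S_def
    proof (rule span_minimal)
      show "T ` (\<lambda>j. (T ^^ j) x) ` {..<N} \<subseteq> span ((\<lambda>j. (T ^^ j) x) ` {..<N})"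
      proof clarify
        fix j assume "j < N"
        show "T ((T ^^ j) x) \<in> span ((\<lambda>j. (T ^^ j) x) ` {..<N})"
        proof (cases "Suc j = N")
          case True
          then show ?thesis using N(2) by (auto simp: S_def)
        next
          case False
          then show ?thesis using \<open>j < N\<close>
            by (intro span_base image_eqI[of _ _ "Suc j"]) auto
        qed
      qed
    qed simp
    finally show ?thesis using that by blast
  qed
  have "(T ^^ m) x \<in> S N"
  proof (induction m)
    case 0
    show ?case
      using N(2) by (cases N) (auto simp: S_def intro!: span_base image_eqI[of _ _ 0])
  qed (simp add: T)
  then show ?thesis using S_mono[OF N(1)] by (auto simp: S_def)
qed

text \<open>The vector \<open>P(M) v\<close>, evaluated by Horner's rule without forming a
  polynomial in matrices.\<close>

definition mpoly :: "('n::finite) cmat \<Rightarrow> 'n cvec \<Rightarrow> complex poly \<Rightarrow> 'n cvec" where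
  "mpoly M v P = fold_coeffs (\<lambda>a w. a *s v + M *v w) P 0"

lemma mpoly_0 [simp]: "mpoly M v 0 = 0"
  by (simp add: mpoly_def)

lemma mpoly_pCons [simp]: "mpoly M v (pCons a P) = a *s v + M *v mpoly M v P"
  by (cases "a = 0 \<and> P = 0") (auto simp: mpoly_def)

lemma mpoly_add: "mpoly M v (P + Q) = mpoly M v P + mpoly M v Q"
  by (induction P Q rule: poly_induct2) (auto simp: vector_sadd_rdistrib matrix_vector_right_distrib)

lemma mpoly_smult: "mpoly M v (smult c P) = c *s mpoly M v P"
  by (induction P) (auto simp: matvec_scale vector_add_ldistrib vector_smult_assoc)

lemma mpoly_monom: "mpoly M v (monom 1 j) = ((*v) M ^^ j) v"
  by (induction j) (auto simp: monom_0 monom_Suc)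

lemma mpoly_in_subspace:
  assumes "vec.subspace K" "\<And>w. w \<in> K \<Longrightarrow> M *v w \<in> K" "v \<in> K"
  shows "mpoly M v P \<in> K"
  using assms by (induction P) (auto simp: vec.subspace_0 vec.subspace_add vec.subspace_scale)

text \<open>Take a polynomial \<open>R\<close> of least degree annihilating \<open>v\<close> and
  split off a root, \<open>R = (x - r) Q\<close>. Then \<open>Q(M) v\<close> is nonzero by
  minimality and is an eigenvector for \<open>r\<close>.\<close>

lemma eigenvector_in_subspace:
  fixes M :: "('n::finite) cmat"
  assumes K: "vec.subspace K" "\<And>w. w \<in> K \<Longrightarrow> M *v w \<in> K" and v: "v \<in> K" "v \<noteq> 0"
  obtains u a where "u \<in> K" "u \<noteq> 0" "M *v u = a *s u"
proof -
  let ?N = "DIM('n cvec)"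
  \<comment> \<open>\<open>?N\<close> is the real dimension, as the span in
    \<open>cyclic_span\<close> is real. This overshoots the complex dimension harmlessly, since any
    nonzero annihilating polynomial will do.\<close>
  let ?S = "mpoly M v ` {P. P = 0 \<or> degree P < ?N}"
  have "subspace ?S"
  proof (rule subspaceI)
    show "0 \<in> ?S" by (rule image_eqI[of _ _ 0]) auto
  next
    fix x y assume "x \<in> ?S" "y \<in> ?S"
    then obtain P Q where "x = mpoly M v P" "y = mpoly M v Q" "P = 0 \<or> degree P < ?N" "Q = 0 \<or> degree Q < ?N"
      by auto
    then show "x + y \<in> ?S"
      by (intro image_eqI[of _ _ "P + Q"]) (auto simp: mpoly_add intro: degree_add_less)
  next
    fix c x assume "x \<in> ?S"
    then obtain P where "x = mpoly M v P" "P = 0 \<or> degree P < ?N"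
      by auto
    then show "c *\<^sub>R x \<in> ?S"
      by (intro image_eqI[of _ _ "smult (of_real c) P"])
        (auto simp: mpoly_smult vec_eq_iff scaleR_conv_of_real[where 'a=complex])
  qed
  then have "span ((\<lambda>j. ((*v) M ^^ j) v) ` {..<?N}) \<subseteq> ?S"
    by (intro span_minimal) (auto simp: degree_monom_eq simp flip: mpoly_monom)
  then have "((*v) M ^^ ?N) v \<in> ?S"
    using cyclic_span[of "(*v) M" ?N v] by auto
  then obtain P where P: "((*v) M ^^ ?N) v = mpoly M v P" "P = 0 \<or> degree P < ?N"
    by auto
  define R0 where "R0 = monom 1 ?N + smult (-1) P"
  have "coeff R0 ?N = 1" using P(2) by (auto simp: R0_def coeff_eq_0)
  then have "R0 \<noteq> 0" by auto
  have "mpoly M v R0 = mpoly M v P + (-1) *s mpoly M v P"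
    unfolding R0_def mpoly_add mpoly_smult mpoly_monom P(1) ..
  with \<open>R0 \<noteq> 0\<close> have "R0 \<noteq> 0 \<and> mpoly M v R0 = 0" by (simp add: vec_eq_iff)
  then obtain R where R: "R \<noteq> 0" "mpoly M v R = 0"
      and min: "\<And>Q. Q \<noteq> 0 \<Longrightarrow> mpoly M v Q = 0 \<Longrightarrow> degree R \<le> degree Q"
    using ex_has_least_nat[of "\<lambda>R. R \<noteq> 0 \<and> mpoly M v R = 0" R0 degree] by blast
  have "degree R \<noteq> 0"
  proof
    assume "degree R = 0"
    then obtain c where "R = [:c:]" by (rule degree_eq_zeroE)
    then show False using R v by simp
  qed
  then have "\<not> constant (poly R)" by (simp add: constant_degree)
  then obtain r where "poly R r = 0" using fundamental_theorem_of_algebra by blast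
  then obtain Q where Q: "R = [:-r, 1:] * Q" by (metis poly_eq_0_iff_dvd dvdE)
  have "Q \<noteq> 0" using R Q by auto
  then have "degree R = Suc (degree Q)" unfolding Q by (subst degree_mult_eq) auto
  then have nz: "mpoly M v Q \<noteq> 0" using min[OF \<open>Q \<noteq> 0\<close>] by auto
  have "mpoly M v R = (- r) *s mpoly M v Q + M *v mpoly M v Q"
    unfolding Q mult_pCons_left mpoly_add mpoly_smult by simp
  then have "M *v mpoly M v Q = r *s mpoly M v Q"
    using R by (simp add: vec_eq_iff add_eq_0_iff)
  then show ?thesis using that nz mpoly_in_subspace[OF K v(1)] by blast
qed

text \<open>In a nonzero invariant subspace of least dimension, an eigenspace of one
  \<open>Z j\<close> is again invariant by commutation, hence everything. So every vector of it is a
  joint eigenvector, even for infinitely many maps.\<close>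

lemma joint_eigenvector:
  fixes Z :: "nat \<Rightarrow> ('n::finite) cmat"
  assumes K: "vec.subspace K" "\<And>j w. w \<in> K \<Longrightarrow> Z j *v w \<in> K" and v: "v \<in> K" "v \<noteq> 0"
    and comm: "\<And>i j w. w \<in> K \<Longrightarrow> Z i *v (Z j *v w) = Z j *v (Z i *v w)"
  obtains u where "u \<in> K" "u \<noteq> 0" "\<And>j. \<exists>a. Z j *v u = a *s u"
proof -
  let ?P = "\<lambda>W. vec.subspace W \<and> W \<subseteq> K \<and> (\<exists>v\<in>W. v \<noteq> 0) \<and> (\<forall>j. \<forall>w\<in>W. Z j *v w \<in> W)"
  have "?P K" using K v by blast
  then obtain W where W: "?P W" and min: "\<And>W'. ?P W' \<Longrightarrow> vec.dim W \<le> vec.dim W'"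
    using ex_has_least_nat[of ?P K vec.dim] by blast
  obtain u where u: "u \<in> W" "u \<noteq> 0" using W by blast
  have "\<exists>a. Z j *v u = a *s u" for j
  proof -
    obtain x a where x: "x \<in> W" "x \<noteq> 0" "Z j *v x = a *s x"
      using W u eigenvector_in_subspace[of W "Z j" u] by metis
    let ?E = "{w\<in>W. Z j *v w = a *s w}"
    have "vec.subspace ?E"
      using W by (auto simp: vec.subspace_def matrix_vector_right_distrib vector_add_ldistrib matvec_scale vector_smult_assoc mult.commute)
    moreover have "Z i *v w \<in> ?E" if "w \<in> ?E" for i w
    proof -
      have "w \<in> K" using that W by blast
      then have "Z j *v (Z i *v w) = a *s (Z i *v w)"
        using that comm[of w j i] by (simp add: matvec_scale)
      then show ?thesis using that W by blast
    qed
    ultimately have "?P ?E" using x W by blast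
    then have "vec.dim W \<le> vec.dim ?E" by (rule min)
    then have "?E = W"
      using \<open>vec.subspace ?E\<close> W by (intro vec.subspace_dim_equal) auto
    then show ?thesis using u by blast
  qed
  then show ?thesis using that u W by blast
qed

lemma hinv_invariant:
  assumes "M \<in> U1n" "vec.subspace W" "\<And>w. w \<in> W \<Longrightarrow> M *v w \<in> W" "v \<in> W"
  shows "hinv M *v v \<in> W"
proof -
  have inj: "inj ((*v) M)" using hinv_left_vec[OF assms(1)] by (metis injI)
  have "vec.dim ((*v) M ` W) = vec.dim W"
    by (rule vec.dim_image_eq) (auto intro: inj_on_subset[OF inj])
  then have "(*v) M ` W = W"
    using assms by (intro vec.subspace_dim_equal) (auto intro!: vec.subspace_image)
  then obtain w where "w \<in> W" "v = M *v w" using assms(4) by blast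
  then show ?thesis using assms(1) by simp
qed

text \<open>Squaring multiplies the distance to 1 by \<open>cmod (x + 1)\<close>, which is at least
  2 - 2/3 = 4/3; repeated squaring would make the distance unbounded.\<close>

lemma powers_near_one:
  fixes w :: complex
  assumes "\<And>m. cmod (w ^ m - 1) \<le> 2/3"
  shows "w = 1"
proof (rule ccontr)
  assume "w \<noteq> 1"
  have step: "(4/3) ^ j * cmod (w - 1) \<le> cmod (w ^ (2 ^ j) - 1)" for j
  proof (induction j)
    case (Suc j)
    let ?x = "w ^ (2 ^ j)"
    have "w ^ (2 ^ Suc j) - 1 = (?x + 1) * (?x - 1)"
      by (simp add: power_mult power2_eq_square algebra_simps flip: power_mult_distrib)
    then have eq: "cmod (w ^ (2 ^ Suc j) - 1) = cmod (?x + 1) * cmod (?x - 1)"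
      by (simp add: norm_mult)
    have "2 \<le> cmod (?x + 1) + cmod (?x - 1)"
      using norm_triangle_ineq4[of "?x + 1" "?x - 1"] by simp
    then have "4/3 \<le> cmod (?x + 1)" using assms[of "2 ^ j"] by linarith
    then have "4/3 * ((4/3) ^ j * cmod (w - 1)) \<le> cmod (?x + 1) * cmod (?x - 1)"
      using Suc by (intro mult_mono) auto
    then show ?case using eq by simp
  qed simp
  have pos: "cmod (w - 1) > 0" using \<open>w \<noteq> 1\<close> by simp
  obtain j where "1 / cmod (w - 1) < (4/3::real) ^ j"
    using real_arch_pow[of "4/3"] by auto
  then have "1 < (4/3) ^ j * cmod (w - 1)" using pos by (simp add: field_simps)
  then show False using step[of j] assms[of "2 ^ j"] by linarith
qed

text \<open>Parallelism of \<open>M *v y\<close> and \<open>y\<close> is the vanishing of 2 by 2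
  minors, a closed condition; no convergence of the eigenvalues is needed.\<close>

lemma eigen_limit:
  fixes M :: "('n::finite) cmat"
  assumes "y \<longlonglongrightarrow> x" "x \<noteq> 0" "\<And>j. \<exists>b. M *v y j = b *s y j"
  shows "\<exists>b. M *v x = b *s x"
proof -
  have My: "(\<lambda>j. M *v y j) \<longlonglongrightarrow> M *v x"
    using bounded_linear.tendsto[OF bounded_linear_matvec assms(1)] .
  have cross: "(M *v x) $ i * x $ k = (M *v x) $ k * x $ i" for i k
  proof (rule LIMSEQ_unique)
    show "(\<lambda>j. (M *v y j) $ i * y j $ k) \<longlonglongrightarrow> (M *v x) $ i * x $ k"
      by (intro tendsto_intros My assms(1))
    have "(M *v y j) $ i * y j $ k = (M *v y j) $ k * y j $ i" for j
      using assms(3)[of j] by auto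
    moreover have "(\<lambda>j. (M *v y j) $ k * y j $ i) \<longlonglongrightarrow> (M *v x) $ k * x $ i"
      by (intro tendsto_intros My assms(1))
    ultimately show "(\<lambda>j. (M *v y j) $ i * y j $ k) \<longlonglongrightarrow> (M *v x) $ k * x $ i"
      by simp
  qed
  obtain k where k: "x $ k \<noteq> 0" using assms(2) by (auto simp: vec_eq_iff)
  have "M *v x = ((M *v x) $ k / x $ k) *s x"
    using cross k by (simp add: vec_eq_iff field_simps)
  then show ?thesis by blast
qed

subsection \<open>Small elements of discrete groups containing a loxodromic\<close>

lemma scaleR_matvec: "(c *\<^sub>R M) *v x = c *\<^sub>R ((M :: 'n::finite cmat) *v x)"
  by (simp add: matrix_vector_mult_def vec_eq_iff scaleR_sum_right)

lemma matvec_scaleR: "(M :: 'n::finite cmat) *v (c *\<^sub>R x) = c *\<^sub>R (M *v x)"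
  by (simp add: matrix_vector_mult_def vec_eq_iff scaleR_sum_right)

text \<open>The commutator minus the identity equals \<open>(z-1)(u-1) - (u-1)(z-1)\<close> times
  the two inverses, so it is of second order in the distances.\<close>

lemma commutator_contraction:
  "\<exists>e>0. \<forall>z\<in>U1n. \<forall>u\<in>U1n. norm (z - mat 1) \<le> 1 \<longrightarrow> norm (u - mat 1) \<le> e \<longrightarrow>
     norm (z ** u ** hinv z ** hinv u - (mat 1 :: ('n::finite) cmat)) \<le> norm (z - mat 1) / 2"
proof -
  obtain C where C: "C > 0" "\<And>(X::'n cmat) (Y::'n cmat). norm (X ** Y) \<le> C * norm X * norm Y"
    using norm_matmat_bound by blast
  define B where "B = norm (mat 1 :: 'n cmat) + 1"
  have B: "B > 0" by (simp add: B_def add_nonneg_pos)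
  \<comment> \<open>Four matrix products enter, three of them consecutive: the estimate is
    \<open>2 * C ^ 3 * B ^ 2\<close> times both distances, and this \<open>e\<close> leaves a factor
    1/2. The minimum with 1 ensures that \<open>B\<close> also bounds \<open>u\<close>.\<close>
  define e where "e = min 1 (1 / (4 * C ^ 3 * B ^ 2))"
  have "e > 0" using B C by (simp add: e_def)
  moreover have "norm (z ** u ** hinv z ** hinv u - mat 1) \<le> norm (z - mat 1) / 2"
    if z: "z \<in> U1n" "norm (z - mat 1) \<le> 1" and u: "u \<in> U1n" "norm (u - mat 1) \<le> e" for z u :: "'n cmat"
  proof -
    let ?a = "norm (z - mat 1)" and ?b = "norm (u - mat 1)"
    have nB: "norm X \<le> B" if "norm (X - mat 1) \<le> 1" for X :: "'n cmat"
      using norm_triangle_ineq[of "mat 1" "X - mat 1"] that by (simp add: B_def)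
    have zB: "norm (hinv z) \<le> B" and uB: "norm (hinv u) \<le> B"
      using nB z u by (auto simp: e_def)
    let ?Y = "(z - mat 1) ** (u - mat 1) - (u - mat 1) ** (z - mat 1)"
    have "?Y = z ** u - u ** z"
      by (simp add: matrix_diff_distrib_left matrix_diff_distrib_right)
    then have "?Y ** hinv z ** hinv u = z ** u ** hinv z ** hinv u - mat 1"
      using z u by (simp add: matrix_diff_distrib_right hinv_right flip: matrix_mul_assoc)
    then have "norm (z ** u ** hinv z ** hinv u - mat 1) = norm (?Y ** hinv z ** hinv u)" by simp
    also have "\<dots> \<le> C * norm (?Y ** hinv z) * norm (hinv u)" by (rule C(2))
    also have "\<dots> \<le> C * (C * norm ?Y * norm (hinv z)) * norm (hinv u)"
      by (intro mult_right_mono mult_left_mono C(2)) (use C in auto)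
    also have "\<dots> \<le> C * (C * norm ?Y * B) * B"
      using C zB uB B by (intro mult_mono mult_left_mono) auto
    also have "norm ?Y \<le> C * ?a * ?b + C * ?b * ?a"
      by (rule norm_triangle_le_diff[OF add_mono]) (rule C(2))+
    also have "C * (C * (C * ?a * ?b + C * ?b * ?a) * B) * B = (2 * C ^ 3 * B ^ 2 * ?b) * ?a"
      by (simp add: power2_eq_square power3_eq_cube algebra_simps)
    also have "\<dots> \<le> (1 / 2) * ?a"
    proof (rule mult_right_mono)
      have "2 * C ^ 3 * B ^ 2 * ?b \<le> 2 * C ^ 3 * B ^ 2 * (1 / (4 * C ^ 3 * B ^ 2))"
        using u C B by (intro mult_left_mono) (auto simp: e_def)
      then show "2 * C ^ 3 * B ^ 2 * ?b \<le> 1 / 2" using C B by simp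
    qed simp
    finally show ?thesis using C B by (simp add: mult_left_mono mult_right_mono)
  qed
  ultimately show ?thesis by blast
qed

text \<open>Conjugation by \<open>z\<close> multiplies the eigenvalues of \<open>u\<close> by \<open>inverse c\<close>, and all powers of
  \<open>inverse c\<close> cannot be close to 1.\<close>

lemma scalar_commutator_trivial:
  "\<exists>e>0. \<forall>V c (z :: ('n::finite) cmat) u. vec.subspace V \<longrightarrow> (\<exists>v\<in>V. v \<noteq> 0) \<longrightarrow> z \<in> U1n \<longrightarrow>
     (\<forall>v\<in>V. z *v v \<in> V \<and> u *v v \<in> V \<and> z *v (u *v v) = c *s (u *v (z *v v))) \<longrightarrow>
     norm (u - mat 1) \<le> e \<longrightarrow> c = 1"
proof -
  obtain C where C: "C > 0" "\<And>M x. norm ((M::'n cmat) *v x) \<le> C * norm M * norm x"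
    using norm_matvec_bound by blast
  \<comment> \<open>Puts every eigenvalue of \<open>u\<close> within 1/4 of 1.\<close>
  define e where "e = 1 / (4 * C)"
  have "e > 0" using C by (simp add: e_def)
  moreover have "c = 1"
    if V: "vec.subspace V" "x \<in> V" "x \<noteq> 0" and z: "z \<in> U1n"
      and zu: "\<And>v. v \<in> V \<Longrightarrow> z *v v \<in> V" "\<And>v. v \<in> V \<Longrightarrow> u *v v \<in> V"
        "\<And>v. v \<in> V \<Longrightarrow> z *v (u *v v) = c *s (u *v (z *v v))"
      and u: "norm (u - mat 1) \<le> e" for V c x and z u :: "'n cmat"
  proof -
    have near: "cmod (a - 1) \<le> 1/4" if "u *v v = a *s v" "v \<noteq> 0" for a v
    proof -
      have "(u - mat 1) *v v = (a - 1) *s v"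
        using that by (simp add: matrix_vector_mult_diff_rdistrib vector_sub_rdistrib)
      then have "norm ((a - 1) *s v) \<le> C * norm (u - mat 1) * norm v"
        using C(2)[of "u - mat 1" v] by metis
      then have "cmod (a - 1) * norm v \<le> C * norm (u - mat 1) * norm v"
        by (simp only: norm_scale)
      then have "cmod (a - 1) \<le> C * norm (u - mat 1)" using that by simp
      also have "\<dots> \<le> C * e" using u C by simp
      finally show ?thesis using C by (simp add: e_def)
    qed
    obtain v a where v: "v \<in> V" "v \<noteq> 0" "u *v v = a *s v"
      using eigenvector_in_subspace[OF V(1) zu(2) V(2,3)] by metis
    have a: "cmod (a - 1) \<le> 1/4" using near v by blast
    then have "a \<noteq> 0" by auto
    have znz: "z *v v \<noteq> 0" if "v \<noteq> 0" for v using that hinv_left_vec[OF z, of v] by auto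
    have "c \<noteq> 0"
      using zu(3)[OF v(1)] znz[OF v(2)] \<open>a \<noteq> 0\<close> v(3) by (auto simp: matvec_scale)
    have "\<exists>y\<in>V. y \<noteq> 0 \<and> u *v y = (inverse c ^ m * a) *s y" for m
    proof (induction m)
      case 0
      then show ?case using v by auto
    next
      case (Suc m)
      then obtain y where y: "y \<in> V" "y \<noteq> 0" "u *v y = (inverse c ^ m * a) *s y" by blast
      have "c *s (u *v (z *v y)) = (inverse c ^ m * a) *s (z *v y)"
        using zu(3)[OF y(1)] y(3) by (simp add: matvec_scale)
      then have "inverse c *s (c *s (u *v (z *v y))) = inverse c *s ((inverse c ^ m * a) *s (z *v y))"
        by simp
      then have "u *v (z *v y) = (inverse c ^ Suc m * a) *s (z *v y)"
        using \<open>c \<noteq> 0\<close> by (simp add: vector_smult_assoc mult.assoc)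
      then show ?case using y znz zu(1) by blast
    qed
    then have pw: "cmod (inverse c ^ m * a - 1) \<le> 1/4" for m using near by blast
    \<comment> \<open>Two numbers within 1/4 of 1 differ by at most 1/2; dividing by
      \<open>cmod a \<ge> 3/4\<close> gives 2/3.\<close>
    have "cmod (inverse c ^ m - 1) \<le> 2/3" for m
    proof -
      have "cmod ((inverse c ^ m * a - 1) - (a - 1)) \<le> 1/4 + 1/4"
        by (rule norm_triangle_le_diff[OF add_mono[OF pw a]])
      then have "cmod (inverse c ^ m - 1) * cmod a \<le> 1/2"
        by (simp add: algebra_simps flip: norm_mult)
      moreover have "cmod a \<ge> 3/4"
        using norm_triangle_ineq2[of 1 "1 - a"] a by (simp add: norm_minus_commute)
      then have "cmod (inverse c ^ m - 1) * (3/4) \<le> cmod (inverse c ^ m - 1) * cmod a"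
        by (intro mult_left_mono) auto
      ultimately show ?thesis by linarith
    qed
    then show "c = 1" using powers_near_one inverse_eq_1_iff by metis
  qed
  ultimately show ?thesis by (intro exI[of _ e]) blast
qed

section \<open>Conjugates by powers of a loxodromic element\<close>

context lox
begin

definition cj :: "nat \<Rightarrow> 'n cmat \<Rightarrow> 'n cmat" where
  "cj j X = mpow A j ** X ** hinv (mpow A j)"

lemma cj_vec: "cj j X *v v = mpow A j *v (X *v (hinv (mpow A j) *v v))"
  by (simp add: cj_def flip: matrix_vector_mul_assoc)

lemma cj_0 [simp]: "cj 0 X = X"
  by (simp add: cj_def)

lemma cj_add: "cj (i + j) X = cj i (cj j X)"
  by (simp add: cj_def mpow_add hinv_mult matrix_mul_assoc)

lemma cj_Suc_vec: "cj (Suc j) X *v v = A *v (cj j X *v (hinv A *v v))"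
  by (simp add: cj_vec hinv_mult flip: matrix_vector_mul_assoc)

lemma cj_in_span: "cj j X \<in> span ((\<lambda>j. cj j X) ` {..<DIM('n cmat)})"
proof -
  let ?T = "\<lambda>X. A ** X ** hinv A"
  have "linear ?T"
    by (rule linearI)
      (auto simp: matrix_matrix_mult_def vec_eq_iff sum.distrib algebra_simps sum_distrib_left scaleR_sum_right)
  moreover have "(?T ^^ j) X = cj j X" for j
    by (induction j) (auto simp: cj_def hinv_mult matrix_mul_assoc)
  ultimately show ?thesis using cyclic_span[of ?T j X] by simp
qed

text \<open>Conjugation by \<open>A\<close> is a linear map on matrices, so finitely many conjugates
  span all of them. This matters because closeness to the identity can be kept uniformly only for
  finitely many powers.\<close>

lemma cj_commute_all:
  assumes "\<And>j. j < DIM('n cmat) \<Longrightarrow> \<forall>v\<in>V. M *v (cj j X *v v) = cj j X *v (M *v v)" "v \<in> V"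
  shows "M *v (cj j X *v v) = cj j X *v (M *v v)"
proof -
  let ?S = "{Y. \<forall>v\<in>V. M *v (Y *v v) = Y *v (M *v v)}"
  have "subspace ?S"
  proof (rule subspaceI)
    show "0 \<in> ?S" by simp
    show "X + Y \<in> ?S" if "X \<in> ?S" "Y \<in> ?S" for X Y
      using that unfolding mem_Collect_eq matrix_vector_mult_add_rdistrib matrix_vector_right_distrib by metis
    show "c *\<^sub>R X \<in> ?S" if "X \<in> ?S" for c X
      using that unfolding mem_Collect_eq scaleR_matvec matvec_scaleR by metis
  qed
  then have "span ((\<lambda>j. cj j X) ` {..<DIM('n cmat)}) \<subseteq> ?S"
    using assms(1) by (intro span_minimal) auto
  then show ?thesis using cj_in_span[of j X] assms(2) by blast
qed

lemma cj_norm_bound: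
  obtains K where "K \<ge> 1"
    "\<And>j X. j < N \<Longrightarrow> norm (cj j X) \<le> K * norm X"
    "\<And>j X. j < N \<Longrightarrow> norm (hinv (mpow A j) ** X ** mpow A j) \<le> K * norm X"
proof -
  obtain C where C: "C > 0" "\<And>(X::'n cmat) (Y::'n cmat). norm (X ** Y) \<le> C * norm X * norm Y"
    using norm_matmat_bound by blast
  define k where "k j = C * C * (norm (mpow A j))\<^sup>2" for j
  define K where "K = 1 + (\<Sum>j<N. k j)"
  have k: "k j \<ge> 0" for j using C by (simp add: k_def)
  then have "K \<ge> 1" by (simp add: K_def sum_nonneg)
  have kK: "k j \<le> K" if "j < N" for j
    using that k member_le_sum[of j "{..<N}" k] by (simp add: K_def)
  have b: "norm (X ** Y ** Z) \<le> C * C * norm X * norm Z * norm Y" for X Y Z :: "'n cmat"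
  proof -
    have "norm (X ** Y ** Z) \<le> C * norm (X ** Y) * norm Z" by (rule C(2))
    also have "\<dots> \<le> C * (C * norm X * norm Y) * norm Z"
      using C by (intro mult_right_mono mult_left_mono) auto
    finally show ?thesis by (simp add: mult_ac)
  qed
  have "norm (cj j X) \<le> k j * norm X" "norm (hinv (mpow A j) ** X ** mpow A j) \<le> k j * norm X" for j X
    using b[of "mpow A j" X "hinv (mpow A j)"] b[of "hinv (mpow A j)" X "mpow A j"]
    by (simp_all add: cj_def k_def power2_eq_square mult_ac)
  moreover have "k j * norm X \<le> K * norm X" if "j < N" for j and X :: "'n cmat"
    using kK[OF that] by (rule mult_right_mono) simp
  ultimately show ?thesis using that \<open>K \<ge> 1\<close> order_trans by meson
qed

text \<open>Either some joint eigenvector has a \<open>q\<close>-component, and pulling it back by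
  powers of \<open>A\<close> drives it to \<open>q\<close>; or all joint eigenvectors are orthogonal
  to \<open>p\<close>, and one among those orthogonal to all joint eigenvectors must be null and
  hence lie on the line of \<open>p\<close>.\<close>

lemma commuting_conjugates_fixed_point:
  assumes V: "vec.subspace V" "p \<in> V" and z: "z \<in> U1n"
    and inv: "\<And>j v. v \<in> V \<Longrightarrow> cj j z *v v \<in> V"
    and comm: "\<And>i j v. v \<in> V \<Longrightarrow> cj i z *v (cj j z *v v) = cj j z *v (cj i z *v v)"
  shows "(\<exists>b. z *v p = b *s p) \<or> (\<exists>b. z *v q = b *s q)"
proof -
  define J where "J = {v\<in>V. v \<noteq> 0 \<and> (\<forall>j. \<exists>b. cj j z *v v = b *s v)}"
  have cU: "cj j z \<in> U1n" for j using z by (simp add: cj_def)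
  show ?thesis
  proof (cases "\<exists>v\<in>J. herm v p \<noteq> 0")
    case True
    then obtain v where v: "v \<in> J" "herm v p \<noteq> 0" by blast
    obtain K where K: "K > 0" "\<And>j y. herm y p = 0 \<Longrightarrow> norm (hinv (mpow A j) *v y) \<le> K * norm y"
      using inv_power_bound by blast
    define b where "b = herm v p / herm q p"
    have "b \<noteq> 0" using v by (simp add: b_def)
    define y where "y = v - b *s q"
    have y: "herm y p = 0" by (simp add: y_def b_def herm_diff_left herm_simps)
    \<comment> \<open>Rescaled pull-backs of \<open>v\<close>. Each is an eigenvector of
      \<open>z\<close>, because \<open>v\<close> is one of \<open>cj j z\<close>, and the factor
      \<open>m ^ j\<close> keeps the \<open>q\<close>-component constant while the rest tends to
      0.\<close>
    define x where "x j = m ^ j *s (hinv (mpow A j) *v v)" for j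
    have hP: "hinv (mpow A j) *v q = inverse (m ^ j) *s q" for j
      using hinv_eigen(2)[OF _ mpow_eigen[OF A_q]] by simp
    have xj: "x j = b *s q + m ^ j *s (hinv (mpow A j) *v y)" for j
    proof -
      have "v = b *s q + y" by (simp add: y_def)
      then show ?thesis
        by (simp add: x_def matrix_vector_right_distrib matvec_scale hP vector_add_ldistrib vector_smult_assoc)
    qed
    have "(\<lambda>j. m ^ j *s (hinv (mpow A j) *v y)) \<longlonglongrightarrow> 0"
    proof (rule Lim_null_comparison)
      show "\<forall>\<^sub>F j in sequentially. norm (m ^ j *s (hinv (mpow A j) *v y)) \<le> cmod m ^ j * (K * norm y)"
        unfolding norm_scale norm_power by (intro always_eventually allI mult_left_mono K(2) y) auto
      have "cmod m < 1" using l_gt by (simp add: cmod_m inverse_less_1_iff)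
      then show "(\<lambda>j. cmod m ^ j * (K * norm y)) \<longlonglongrightarrow> 0"
        by (intro tendsto_mult_left_zero LIMSEQ_power_zero) auto
    qed
    then have "x \<longlonglongrightarrow> b *s q"
      unfolding xj using tendsto_add[OF tendsto_const] by fastforce
    moreover have "b *s q \<noteq> 0" using \<open>b \<noteq> 0\<close> by simp
    moreover have "\<exists>c. z *v x j = c *s x j" for j
    proof -
      obtain c where "cj j z *v v = c *s v" using v by (auto simp: J_def)
      then have "hinv (mpow A j) *v (cj j z *v v) = c *s (hinv (mpow A j) *v v)"
        by (simp add: matvec_scale)
      then have "z *v (hinv (mpow A j) *v v) = c *s (hinv (mpow A j) *v v)"
        by (simp add: cj_vec)
      then show ?thesis by (auto simp: x_def matvec_scale vector_smult_assoc mult.commute)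
    qed
    ultimately obtain c where "z *v (b *s q) = c *s (b *s q)" using eigen_limit by blast
    then have "inverse b *s (z *v (b *s q)) = inverse b *s (c *s (b *s q))" by simp
    then have "z *v q = c *s q" using \<open>b \<noteq> 0\<close> by (simp add: matvec_scale vector_smult_assoc)
    then show ?thesis by blast
  next
    case False
    \<comment> \<open>\<open>W\<close> contains \<open>p\<close> and is invariant, so it contains a
      joint eigenvector \<open>f\<close>. Lying in both \<open>J\<close> and its orthogonal
      complement, \<open>f\<close> is orthogonal to itself.\<close>
    define W where "W = {v\<in>V. \<forall>f\<in>J. herm v f = 0}"
    have "vec.subspace W"
      using V by (auto simp: W_def vec.subspace_def herm_simps)
    moreover have "p \<in> W" using False V by (auto simp: W_def herm_eq_0_commute[of p])
    moreover have "cj j z *v w \<in> W" if "w \<in> W" for j w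
    proof -
      have "herm (cj j z *v w) f = 0" if f: "f \<in> J" for f
      proof -
        obtain b where "cj j z *v f = b *s f" using f by (auto simp: J_def)
        then have "hinv (cj j z) *v f = inverse b *s f"
          using hinv_eigen(2)[OF cU] f by (auto simp: J_def)
        then show ?thesis using \<open>w \<in> W\<close> f by (simp add: herm_move[OF cU] herm_simps W_def)
      qed
      then show ?thesis using that inv by (auto simp: W_def)
    qed
    moreover have "cj i z *v (cj j z *v w) = cj j z *v (cj i z *v w)" if "w \<in> W" for i j w
      using that comm by (auto simp: W_def)
    ultimately obtain f where f: "f \<in> W" "f \<noteq> 0" "\<And>j. \<exists>a. cj j z *v f = a *s f"
      using joint_eigenvector[of W "\<lambda>j. cj j z" p] p_nz by metis
    then have "f \<in> J" by (auto simp: J_def W_def)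
    then have "herm f f = 0" "herm f p = 0" using f False by (auto simp: W_def)
    then obtain c where c: "f = c *s p" using null_perp by blast
    then have "c \<noteq> 0" using f by auto
    obtain a where "z *v f = a *s f" using f(3)[of 0] by auto
    then have "inverse c *s (z *v f) = inverse c *s (a *s f)" by simp
    then have "z *v p = a *s p" using \<open>c \<noteq> 0\<close> by (simp add: c matvec_scale vector_smult_assoc)
    then show ?thesis by blast
  qed
qed

lemma cj_eigen:
  assumes "z *v p = a *s p" "z *v q = b *s q"
  shows "cj j z *v p = a *s p" "cj j z *v q = b *s q"
  using hinv_eigen(2)[OF _ mpow_eigen[OF A_p]] hinv_eigen(2)[OF _ mpow_eigen[OF A_q]]
  by (simp_all add: cj_vec assms matvec_scale mpow_eigen[OF A_p] mpow_eigen[OF A_q] vector_smult_assoc)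

text \<open>The element \<open>z\<close> closest to the identity among those that are not scalar on \<open>V\<close> (up to a factor 2)
  commutes on \<open>V\<close> with all small elements of the group, in particular with many conjugates of \<open>z\<close> and \<open>a\<close>
  by powers of \<open>A\<close>; by linear algebra it then commutes with all of them. If \<open>z\<close> has an eigenvalue off the unit circle
  its eigenlines are those of \<open>p\<close> and \<open>q\<close>; otherwise a joint eigenspace contradicts minimality of \<open>V\<close>.\<close>

lemma small_elements_fix:
  "\<exists>d>0. \<forall>\<Gamma> a. mgroup \<Gamma> \<longrightarrow> mdiscrete \<Gamma> \<longrightarrow> A \<in> \<Gamma> \<longrightarrow> a \<in> \<Gamma> \<longrightarrow> norm (a - mat 1) < d \<longrightarrow>
     (\<exists>b. a *v p = b *s p) \<and> (\<exists>b. a *v q = b *s q)"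
proof -
  obtain e1 where e1: "e1 > 0" "\<And>z u. z \<in> U1n \<Longrightarrow> u \<in> U1n \<Longrightarrow> norm (z - mat 1) \<le> 1 \<Longrightarrow> norm (u - mat 1) \<le> e1 \<Longrightarrow>
     norm (z ** u ** hinv z ** hinv u - (mat 1 :: 'n cmat)) \<le> norm (z - mat 1) / 2"
    using commutator_contraction[where 'n='n] by blast
  obtain e2 where e2: "e2 > 0" "\<And>V c (z :: 'n cmat) u. vec.subspace V \<Longrightarrow> (\<exists>v\<in>V. v \<noteq> 0) \<Longrightarrow> z \<in> U1n \<Longrightarrow>
     (\<forall>v\<in>V. z *v v \<in> V \<and> u *v v \<in> V \<and> z *v (u *v v) = c *s (u *v (z *v v))) \<Longrightarrow>
     norm (u - mat 1) \<le> e2 \<Longrightarrow> c = 1"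
    using scalar_commutator_trivial[where 'n='n] by blast
  define e where "e = min 1 (min e1 e2)"
  have e: "e > 0" "e \<le> 1" "e \<le> e1" "e \<le> e2" using e1 e2 by (auto simp: e_def)
  let ?N = "DIM('n cmat)"
  obtain K where K: "K \<ge> 1" "\<And>j X. j < ?N \<Longrightarrow> norm (cj j X) \<le> K * norm X"
    "\<And>j X. j < ?N \<Longrightarrow> norm (hinv (mpow A j) ** X ** mpow A j) \<le> K * norm X"
    using cj_norm_bound[of ?N] by metis
  \<comment> \<open>The chosen \<open>z\<close> is at distance below
    \<open>2 * s < 2 * d = e / K\<close>, so its first \<open>?N\<close> conjugates stay within
    \<open>e\<close> of the identity. The discreteness constant \<open>e0\<close> below does not
    enter.\<close>
  define d where "d = e / (2 * K)"
  have "d > 0" using e K by (simp add: d_def)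
  moreover have "(\<exists>b. a *v p = b *s p) \<and> (\<exists>b. a *v q = b *s q)"
    if \<Gamma>: "mgroup \<Gamma>" "mdiscrete \<Gamma>" "A \<in> \<Gamma>" "a \<in> \<Gamma>" "norm (a - mat 1) < d" for \<Gamma> a
  proof -
    let ?P = "\<lambda>W. vec.subspace W \<and> p \<in> W \<and> q \<in> W \<and> (\<forall>v\<in>W. A *v v \<in> W) \<and> (\<forall>v\<in>W. a *v v \<in> W)"
    \<comment> \<open>The least subspace containing \<open>p\<close> and \<open>q\<close> and stable
      under \<open>A\<close> and \<open>a\<close>. Any smaller subspace with these properties found
      later is already a contradiction, and scalars on \<open>V\<close> suffice for the claim about
      \<open>p\<close> and \<open>q\<close>.\<close>
    define V where "V = \<Inter>{W. ?P W}"
    have V_min: "V \<subseteq> W" if "?P W" for W using that by (auto simp: V_def)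
    have V: "vec.subspace V" "p \<in> V" "q \<in> V" "\<And>v. v \<in> V \<Longrightarrow> A *v v \<in> V" "\<And>v. v \<in> V \<Longrightarrow> a *v v \<in> V"
      unfolding V_def by (auto intro!: vec.subspace_Inter)
    define G where "G = {M\<in>\<Gamma>. \<forall>v\<in>V. M *v v \<in> V}"
    have G: "mgroup G"
      unfolding mgroup_def
    proof (intro conjI ballI)
      show "G \<subseteq> U1n" using mgroupD(1)[OF \<Gamma>(1)] by (auto simp: G_def)
      show "mat 1 \<in> G" using mgroupD(2)[OF \<Gamma>(1)] by (simp add: G_def)
      show "M ** N \<in> G" if "M \<in> G" "N \<in> G" for M N
        using that mgroupD(3)[OF \<Gamma>(1)] by (simp add: G_def flip: matrix_vector_mul_assoc)
      show "hinv M \<in> G" if "M \<in> G" for M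
        using that mgroupD(1,4)[OF \<Gamma>(1)] hinv_invariant[OF _ V(1), of M] by (auto simp: G_def)
    qed
    have GV: "M *v v \<in> V" if "M \<in> G" "v \<in> V" for M v using that by (simp add: G_def)
    have GU: "M \<in> U1n" if "M \<in> G" for M using that G mgroupD by blast
    have AG: "A \<in> G" and aG: "a \<in> G" using \<Gamma> V by (auto simp: G_def)
    obtain e0 where e0: "e0 > 0" "\<And>M. M \<in> \<Gamma> \<Longrightarrow> norm (M - mat 1) < e0 \<Longrightarrow> \<exists>c. M = mat c"
      using \<Gamma>(2) by (auto simp: mdiscrete_def)
    have Gdisc: "mdiscrete G" unfolding mdiscrete_def G_def using e0 by auto
    define scal where "scal M \<longleftrightarrow> (\<exists>c. \<forall>v\<in>V. M *v v = c *s v)" for M :: "'n cmat"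
    show ?thesis
    proof (cases "scal a")
      case True
      then show ?thesis using V by (auto simp: scal_def)
    next
      case False
      define S where "S = (\<lambda>M. norm (M - mat 1)) ` {M\<in>G. \<not> scal M}"
      have aS: "norm (a - mat 1) \<in> S" using aG False by (auto simp: S_def)
      have S_ge: "e0 \<le> x" if "x \<in> S" for x
      proof (rule ccontr)
        assume "\<not> e0 \<le> x"
        then obtain M where M: "M \<in> G" "\<not> scal M" "norm (M - mat 1) < e0"
          using \<open>x \<in> S\<close> by (auto simp: S_def)
        then obtain c where "M = mat c" using e0(2) by (auto simp: G_def)
        then show False using M(2) by (auto simp: scal_def mat_vec)
      qed
      then have bdd: "bdd_below S" by (auto simp: bdd_below_def)
      define s where "s = Inf S"
      have "e0 \<le> s" unfolding s_def using aS S_ge by (intro cInf_greatest) auto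
      then have "s > 0" using e0 by simp
      have s_le: "s \<le> norm (M - mat 1)" if "M \<in> G" "\<not> scal M" for M
        unfolding s_def using that bdd by (intro cInf_lower) (auto simp: S_def)
      \<comment> \<open>The infimum need not be attained. A factor 2 is affordable since the
        commutator estimate halves the distance and lands strictly below \<open>s\<close>, forcing
        the commutator to be scalar on \<open>V\<close>.\<close>
      have "Inf S < 2 * s" using \<open>s > 0\<close> by (simp add: s_def)
      then obtain z where z: "z \<in> G" "\<not> scal z" "norm (z - mat 1) < 2 * s"
        using cInf_lessD[of S "2 * s"] aS by (auto simp: S_def)
      have zU: "z \<in> U1n" using z GU by blast
      have "2 * s < e / K" using s_le[OF aG False] \<Gamma>(5) by (simp add: d_def field_simps)
      then have nz: "norm (z - mat 1) < e / K" using z by simp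
      have na: "norm (a - mat 1) < e / K"
        using \<Gamma>(5) e K by (simp add: d_def field_simps)
      have "e / K \<le> e" using e K by (simp add: field_simps)
      have zcomm: "z *v (u *v v) = u *v (z *v v)" if u: "u \<in> G" "norm (u - mat 1) \<le> e" and v: "v \<in> V" for u v
      proof -
        let ?w = "z ** u ** hinv z ** hinv u"
        have "?w \<in> G" using z u G by (simp add: mgroupD)
        have "norm (?w - mat 1) \<le> norm (z - mat 1) / 2"
          using e1(2)[OF zU GU[OF u(1)]] u nz \<open>e / K \<le> e\<close> e by linarith
        also have "\<dots> < s" using z by simp
        finally have "scal ?w" using s_le[OF \<open>?w \<in> G\<close>] not_le by blast
        then obtain c where c: "\<And>v. v \<in> V \<Longrightarrow> ?w *v v = c *s v" by (auto simp: scal_def)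
        have zu: "z *v (u *v v) = c *s (u *v (z *v v))" if "v \<in> V" for v
        proof -
          have "?w *v (u *v (z *v v)) = z *v (u *v v)"
            using zU GU[OF u(1)] by (simp flip: matrix_vector_mul_assoc)
          then show ?thesis using c[of "u *v (z *v v)"] GV[OF u(1)] GV[OF z(1)] that by simp
        qed
        have "c = 1"
        proof (rule e2(2)[OF V(1) _ zU])
          show "\<exists>v\<in>V. v \<noteq> 0" using V p_nz by blast
          show "\<forall>v\<in>V. z *v v \<in> V \<and> u *v v \<in> V \<and> z *v (u *v v) = c *s (u *v (z *v v))"
            using zu GV[OF u(1)] GV[OF z(1)] by blast
          show "norm (u - mat 1) \<le> e2" using u e by simp
        qed
        then show ?thesis using zu[OF v] by simp
      qed
      have PG: "mpow A j \<in> G" "hinv (mpow A j) \<in> G" for j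
        using mgroup_mpow[OF G AG] mgroupD(4)[OF G] by auto
      have cjG: "cj j M \<in> G" if "M \<in> G" for j M
        unfolding cj_def using that PG mgroupD(3)[OF G] by blast
      have cj1: "cj j M - mat 1 = cj j (M - mat 1)" for j M
        by (simp add: cj_def matrix_diff_distrib_left matrix_diff_distrib_right hinv_right)
      have z_cj: "z *v (cj j z *v v) = cj j z *v (z *v v)" if "v \<in> V" for j v
      proof (rule cj_commute_all[OF _ that], rule ballI)
        fix j v assume "j < ?N" "v \<in> V"
        have "norm (cj j z - mat 1) \<le> K * norm (z - mat 1)"
          unfolding cj1 by (rule K(2)) fact
        also have "\<dots> \<le> e" using nz K by (simp add: field_simps)
        finally show "z *v (cj j z *v v) = cj j z *v (z *v v)"
          using zcomm[OF cjG[OF z(1)]] \<open>v \<in> V\<close> by blast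
      qed
      have a_cj: "a *v (cj j z *v v) = cj j z *v (a *v v)" if "v \<in> V" for j v
      proof (rule cj_commute_all[OF _ that], rule ballI)
        fix j v assume j: "j < ?N" and "v \<in> V"
        \<comment> \<open>Conjugating \<open>a\<close> backwards instead of \<open>z\<close>
          forwards keeps \<open>zcomm\<close> applicable; conjugating the relation by
          \<open>mpow A j\<close> then moves the power onto \<open>z\<close>.\<close>
        let ?u = "hinv (mpow A j) ** a ** mpow A j"
        have "?u \<in> G" using PG aG mgroupD(3)[OF G] by blast
        have "?u - mat 1 = hinv (mpow A j) ** (a - mat 1) ** mpow A j"
          by (simp add: matrix_diff_distrib_left matrix_diff_distrib_right hinv_left)
        then have "norm (?u - mat 1) \<le> K * norm (a - mat 1)"
          using K(3)[OF j] by simp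
        also have "\<dots> \<le> e" using na K by (simp add: field_simps)
        finally have "z *v (?u *v (hinv (mpow A j) *v v)) = ?u *v (z *v (hinv (mpow A j) *v v))"
          using zcomm[OF \<open>?u \<in> G\<close>] GV[OF PG(2) \<open>v \<in> V\<close>] by blast
        then have "mpow A j *v (z *v (?u *v (hinv (mpow A j) *v v))) = mpow A j *v (?u *v (z *v (hinv (mpow A j) *v v)))"
          by simp
        then show "a *v (cj j z *v v) = cj j z *v (a *v v)"
          by (simp add: cj_vec flip: matrix_vector_mul_assoc)
      qed
      have cj_cj: "cj i z *v (cj (i + k) z *v v) = cj (i + k) z *v (cj i z *v v)" if "v \<in> V" for i k v
        using z_cj[of "hinv (mpow A i) *v v" k] GV[OF PG(2) that] by (simp add: cj_add cj_vec)
      have comm: "cj i z *v (cj j z *v v) = cj j z *v (cj i z *v v)" if "v \<in> V" for i j v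
        using cj_cj[OF that, of i "j - i"] cj_cj[OF that, of j "i - j"] by (cases "i \<le> j") auto
      have "(\<exists>b. z *v p = b *s p) \<or> (\<exists>b. z *v q = b *s q)"
        using commuting_conjugates_fixed_point[OF V(1,2) zU] GV[OF cjG[OF z(1)]] comm by blast
      then have "(\<exists>b. z *v p = b *s p) \<and> (\<exists>b. z *v q = b *s q)"
        using shared_fixed_point[OF G Gdisc AG z(1)]
          lox.shared_fixed_point[OF inv_lox G Gdisc mgroupD(4)[OF G AG] z(1)] by blast
      then obtain b c where bc: "z *v p = b *s p" "z *v q = c *s q" by blast
      have b_c: "b * cnj c = 1" by (rule eigenvalues_reciprocal[OF zU bc]) simp
      have aU: "a \<in> U1n" using GU aG by blast
      show ?thesis
      proof (cases "cmod b = 1")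
        case True
        then have "b * cnj b = 1" by (simp flip: complex_norm_square)
        then have "b * cnj b = b * cnj c" "b \<noteq> 0" using b_c by auto
        then have "b = c" by simp
        define W where "W = {v\<in>V. \<forall>j. cj j z *v v = b *s v}"
        have W: "vec.subspace W"
          using V(1) by (auto simp: W_def vec.subspace_def matrix_vector_right_distrib vector_add_ldistrib matvec_scale vector_smult_assoc mult.commute)
        have "p \<in> W" "q \<in> W"
          using V cj_eigen[OF bc] by (auto simp: W_def \<open>b = c\<close>)
        \<comment> \<open>The index shift from \<open>j\<close> to \<open>Suc j\<close> yields
          stability under the inverse of \<open>A\<close>; stability under \<open>A\<close> follows
          by dimension.\<close>
        moreover have "hinv A *v v \<in> W" if "v \<in> W" for v
        proof -
          have "A *v (cj j z *v (hinv A *v v)) = b *s v" for j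
            using that cj_Suc_vec[of j z v] by (simp add: W_def)
          then have "hinv A *v (A *v (cj j z *v (hinv A *v v))) = hinv A *v (b *s v)" for j
            by simp
          then show ?thesis using that GV[OF mgroupD(4)[OF G AG]] by (simp add: W_def matvec_scale)
        qed
        then have "A *v v \<in> W" if "v \<in> W" for v
          using hinv_invariant[OF U1n_hinv[OF A_U] W, of v] that by simp
        moreover have "a *v v \<in> W" if v: "v \<in> W" for v
        proof -
          have "cj j z *v (a *v v) = b *s (a *v v)" for j
            using a_cj[of v j] v by (simp add: W_def matvec_scale)
          then show ?thesis using v V(5) by (simp add: W_def)
        qed
        ultimately have "V \<subseteq> W" using W by (intro V_min) blast
        have "z *v v = b *s v" if "v \<in> V" for v
        proof -
          have "v \<in> W" using that \<open>V \<subseteq> W\<close> by blast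
          then have "cj 0 z *v v = b *s v" unfolding W_def by blast
          then show ?thesis by simp
        qed
        then show ?thesis using z(2) by (auto simp: scal_def)
      next
        case False
        have nb: "b * cnj b \<noteq> 1"
        proof
          assume "b * cnj b = 1"
          then have "cmod b * cmod b = 1" using norm_mult[of b "cnj b"] by simp
          then show False using False by (simp add: power2_eq_1_iff[of "cmod b", unfolded power2_eq_square]) (use norm_ge_zero[of b] in linarith)
        qed
        have nc: "c * cnj c \<noteq> 1"
        proof
          assume "c * cnj c = 1"
          then have "b * cnj c = c * cnj c" "cnj c \<noteq> 0" using b_c by auto
          then have "b = c" by simp
          then show False using nb \<open>c * cnj c = 1\<close> by simp
        qed
        have "z *v (a *v p) = b *s (a *v p)" "z *v (a *v q) = c *s (a *v q)"
          using a_cj[OF V(2), of 0] a_cj[OF V(3), of 0] by (simp_all add: bc matvec_scale)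
        then have "herm (a *v p) p = 0" "herm (a *v q) q = 0"
          using eigenvalues_reciprocal[OF zU _ bc(1)] eigenvalues_reciprocal[OF zU _ bc(2)] nb nc by blast+
        then show ?thesis
          using null_perp[of "a *v p"] null_pair.null_perp[OF swapped, of "a *v q"] by (simp add: U1nD[OF aU])
      qed
    qed
  qed
  ultimately show ?thesis by blast
qed

end

subsection \<open>The projective group and its topology\<close>

lemma scalar_multiple_U1n:
  assumes "M \<in> U1n" "mat c ** M \<in> U1n"
  shows "cmod c = 1"
proof -
  let ?v = "hinv M *v axis None 1"
  have "herm ((mat c ** M) *v ?v) ((mat c ** M) *v ?v) = herm ?v ?v"
    using assms(2) by (rule U1nD)
  moreover have "herm ?v ?v = 1"
    using assms(1) by (simp add: U1nD herm_axis sg_def)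
  moreover have "(mat c ** M) *v ?v = c *s axis None 1"
    using assms(1) by (simp add: mat_vec flip: matrix_vector_mul_assoc)
  ultimately have "c * cnj c = 1"
    by (simp add: herm_simps herm_axis sg_def mult.commute)
  then show ?thesis by (rule cmod_eq_1)
qed

lemma cls_self: "A \<in> cls A"
  unfolding cls_def by (auto intro!: exI[of _ 1])

lemma cls_scale:
  assumes "cmod c = 1"
  shows "cls (mat c ** A) = cls (A :: 'n::finite cmat)"
proof -
  have "c \<noteq> 0" using assms by auto
  show ?thesis
  proof
    show "cls (mat c ** A) \<subseteq> cls A"
      using assms by (auto simp: cls_def matrix_mul_assoc mat_mult_mat norm_mult)
    show "cls A \<subseteq> cls (mat c ** A)"
    proof
      fix B assume "B \<in> cls A"
      then obtain d where "cmod d = 1" "B = mat d ** A" by (auto simp: cls_def)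
      then have "B = mat (d / c) ** (mat c ** A)" "cmod (d / c) = 1"
        using assms \<open>c \<noteq> 0\<close> by (auto simp: matrix_mul_assoc mat_mult_mat norm_divide)
      then show "B \<in> cls (mat c ** A)" unfolding cls_def by blast
    qed
  qed
qed

lemma cls_mem:
  assumes "B \<in> cls A" shows "cls B = cls A"
proof -
  obtain c where "cmod c = 1" "B = mat c ** A" using assms by (auto simp: cls_def)
  then show ?thesis using cls_scale by blast
qed

lemma cls_eq_iff: "cls A = cls B \<longleftrightarrow> (\<exists>c. cmod c = 1 \<and> A = mat c ** B)"
proof
  assume "cls A = cls B"
  then have "A \<in> cls B" using cls_self by blast
  then show "\<exists>c. cmod c = 1 \<and> A = mat c ** B" by (auto simp: cls_def)
qed (use cls_scale in blast)

lemma cls_in_PU [simp]: "A \<in> U1n \<Longrightarrow> cls A \<in> PU"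
  by (simp add: PU_def)

lemma PU_mem:
  assumes "g \<in> PU" "A \<in> g"
  shows "A \<in> U1n \<and> g = cls A"
proof -
  obtain B where B: "B \<in> U1n" "g = cls B" using assms(1) by (auto simp: PU_def)
  then have "cls A = cls B" using assms(2) cls_mem by blast
  moreover obtain c where "cmod c = 1" "A = mat c ** B" using assms(2) B by (auto simp: cls_def)
  ultimately show ?thesis using B U1n_scale by metis
qed

lemma PU_cases:
  assumes "g \<in> PU" obtains A where "A \<in> U1n" "g = cls A"
  using assms by (auto simp: PU_def)

lemma rep_cls: obtains c where "cmod c = 1" "rep (cls A) = mat c ** A"
proof -
  have "rep (cls A) \<in> cls A" unfolding rep_def using cls_self by (rule someI)
  then show ?thesis using that by (auto simp: cls_def)
qed

lemma pu_mult_cls: "pu_mult (cls A) (cls B) = cls (A ** B)"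
proof -
  obtain c where c: "cmod c = 1" "rep (cls A) = mat c ** A" by (rule rep_cls)
  obtain d where d: "cmod d = 1" "rep (cls B) = mat d ** B" by (rule rep_cls)
  have "rep (cls A) ** rep (cls B) = mat c ** (A ** mat d) ** B"
    by (simp add: c d matrix_mul_assoc)
  also have "A ** mat d = mat d ** A" by (rule mat_commute[symmetric])
  also have "mat c ** (mat d ** A) ** B = mat (c * d) ** (A ** B)"
    by (simp add: matrix_mul_assoc mat_mult_mat)
  finally show ?thesis
    using c d by (simp add: pu_mult_def cls_scale norm_mult)
qed

lemma pu_pow_cls: "pu_pow (cls A) k = cls (mpow A k)"
  by (induction k) (auto simp: pu_pow_def pu_one_def pu_mult_cls)

section \<open>Action on points and the normal form of loxodromic classes\<close>

lemma pt_eq_iff: "pt v = pt w \<longleftrightarrow> (\<exists>c. c \<noteq> 0 \<and> v = c *s w)"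
proof
  assume eq: "pt v = pt w"
  have "v \<in> pt v" unfolding pt_def by (auto intro!: exI[of _ 1])
  then have "v \<in> pt w" using eq by simp
  then show "\<exists>c. c \<noteq> 0 \<and> v = c *s w" by (auto simp: pt_def)
next
  assume "\<exists>c. c \<noteq> 0 \<and> v = c *s w"
  then obtain c where c: "c \<noteq> 0" "v = c *s w" by blast
  show "pt v = pt w"
  proof
    show "pt v \<subseteq> pt w" using c by (auto simp: pt_def vector_smult_assoc)
    show "pt w \<subseteq> pt v"
    proof
      fix x assume "x \<in> pt w"
      then obtain d where "d \<noteq> 0" "x = d *s w" by (auto simp: pt_def)
      then have "x = (d / c) *s v" "d / c \<noteq> 0" using c by (auto simp: vector_smult_assoc)
      then show "x \<in> pt v" unfolding pt_def by blast
    qed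
  qed
qed

lemma pt_image: "pt v = (\<lambda>d. d *s v) ` {d. d \<noteq> 0}"
  by (auto simp: pt_def)

lemma act_cls: "act (cls A) (pt v) = pt (A *v v)"
proof -
  obtain c where c: "cmod c = 1" "rep (cls A) = mat c ** A" by (rule rep_cls)
  then have "c \<noteq> 0" by auto
  have "act (cls A) (pt v) = pt (c *s (A *v v))"
  proof -
    have "(mat c ** A) *v (d *s v) = d *s (c *s (A *v v))" for d
      by (simp add: mat_vec matvec_scale vector_smult_assoc mult.commute flip: matrix_vector_mul_assoc)
    then show ?thesis by (simp add: act_def pt_image image_image c(2))
  qed
  then show ?thesis using \<open>c \<noteq> 0\<close> pt_eq_iff by blast
qed

lemma act_fixed_iff:
  assumes "A \<in> U1n" "v \<noteq> 0"
  shows "act (cls A) (pt v) = pt v \<longleftrightarrow> (\<exists>b. A *v v = b *s v)"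
  unfolding act_cls pt_eq_iff using hinv_eigen(1)[OF assms(1) _ assms(2)] by blast

lemma pt_in_bdry: "v \<noteq> 0 \<Longrightarrow> herm v v = 0 \<Longrightarrow> pt v \<in> bdry"
  by (auto simp: bdry_def)

lemma fixset_iff:
  assumes "A \<in> U1n" "v \<noteq> 0" "herm v v = 0"
  shows "pt v \<in> fixset (cls A) \<longleftrightarrow> (\<exists>b. A *v v = b *s v)"
  using assms by (simp add: fixset_def act_fixed_iff pt_in_bdry)

lemma pt_in_hypD: "pt v \<in> hyp \<Longrightarrow> Re (herm v v) > 0"
proof -
  assume "pt v \<in> hyp"
  then obtain w where w: "pt v = pt w" "Re (herm w w) > 0" by (auto simp: hyp_def)
  then obtain c where c: "c \<noteq> 0" "v = c *s w" using pt_eq_iff by blast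
  have "herm v v = (c * cnj c) * herm w w" by (simp add: c herm_simps)
  also have "c * cnj c = complex_of_real ((cmod c)\<^sup>2)" by (rule complex_norm_square[symmetric])
  finally have "Re (herm v v) = (cmod c)\<^sup>2 * Re (herm w w)" by simp
  then show ?thesis using w c by simp
qed

lemma null_orthogonal_parallel:
  assumes "herm p p = 0" "herm v v = 0" "herm v p = 0" "p \<noteq> (0 :: 'n::finite cvec)"
  shows "\<exists>c. v = c *s p"
proof -
  \<comment> \<open>Flipping the signs by the signature gives a null vector whose pairing with
    \<open>p\<close> is the squared Euclidean norm, hence a partner completing \<open>p\<close> to a
    null pair.\<close>
  define r where "r = (\<chi> i. sg i * p $ i)"
  have rr: "herm r r = herm p p" by (simp add: herm_sg r_def mult_ac)
  have "herm p r = (\<Sum>i\<in>UNIV. p $ i * cnj (p $ i))"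
    by (simp add: herm_sg r_def mult_ac)
  moreover have "(norm p)\<^sup>2 = (\<Sum>i\<in>UNIV. (cmod (p $ i))\<^sup>2)"
    by (simp add: norm_vec_def L2_set_def sum_nonneg)
  ultimately have "herm p r = of_real ((norm p)\<^sup>2)"
    by (simp add: complex_norm_square del: of_real_power)
  then have "herm p r \<noteq> 0" using assms(4) by simp
  with rr interpret null_pair p r
    using assms by unfold_locales auto
  show ?thesis using null_perp assms by blast
qed

context null_pair
begin

lemma positive_combination: "Re (herm (p + herm p q *s q) (p + herm p q *s q)) > 0"
proof -
  have "herm (p + herm p q *s q) (p + herm p q *s q) = cnj (herm p q) * herm p q + herm p q * cnj (herm p q)"
    by (simp add: herm_simps cnj_herm)
  then show ?thesis
    by (simp add: complex_norm_square[symmetric] mult.commute)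
qed

lemma pt_neq: "pt p \<noteq> pt q"
proof
  assume "pt p = pt q"
  then obtain c where "p = c *s q" using pt_eq_iff by blast
  then have "herm p q = c * herm q q" by (metis herm_scale_left)
  then show False using herm_pq null_q by simp
qed

end

context lox
begin

lemma fixcl_lox: "fixcl (cls A) = {pt p, pt q}"
proof
  show "{pt p, pt q} \<subseteq> fixcl (cls A)"
    using A_p A_q by (auto simp: fixcl_def act_fixed_iff intro!: pt_in_bdry)
  show "fixcl (cls A) \<subseteq> {pt p, pt q}"
  proof
    fix x assume "x \<in> fixcl (cls A)"
    then have "x \<in> hyp \<union> bdry" and fx: "act (cls A) x = x" by (auto simp: fixcl_def)
    then obtain v where "x = pt v" "Re (herm v v) > 0 \<or> v \<noteq> 0 \<and> herm v v = 0"
      unfolding hyp_def bdry_def by blast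
    with fx have v: "x = pt v" "Re (herm v v) \<ge> 0" "v \<noteq> 0" "act (cls A) (pt v) = pt v"
      by auto
    then obtain a where "A *v v = a *s v" using act_fixed_iff[OF A_U v(3)] by blast
    then consider c where "v = c *s p" | c where "v = c *s q" using eigen_cases v(2) by blast
    then show "x \<in> {pt p, pt q}"
    proof cases
      case 1
      then have "c \<noteq> 0" using v(3) by auto
      then have "pt v = pt p" using 1 pt_eq_iff by blast
      then show ?thesis using v(1) by simp
    next
      case 2
      then have "c \<noteq> 0" using v(3) by auto
      then have "pt v = pt q" using 2 pt_eq_iff by blast
      then show ?thesis using v(1) by simp
    qed
  qed
qed

lemma loxodromic_cls: "loxodromic (cls A)"
  unfolding loxodromic_def
proof (intro conjI exI)
  show "cls A \<noteq> pu_one"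
  proof
    assume "cls A = pu_one"
    then obtain c where "cmod c = 1" "A = mat c" by (auto simp: pu_one_def cls_eq_iff)
    then have "(c - l) *s p = 0" using A_p by (simp add: mat_vec vector_sub_rdistrib)
    then show False using l_gt \<open>cmod c = 1\<close> by auto
  qed
  show "pt p \<noteq> pt q" by (rule pt_neq)
qed (auto simp: fixcl_lox intro!: pt_in_bdry)

end

lemma loxodromic_cases:
  assumes "loxodromic k" "fixcl k = {x, y}" "x \<noteq> y"
  obtains A p q l m where "lox p q A l m" "k = cls A" "{x, y} = {pt p, pt q}"
proof -
  have "k \<in> PU" and "fixcl k \<subseteq> bdry" using assms(1) by (auto simp: loxodromic_def)
  then obtain A where A: "A \<in> U1n" "k = cls A" by (auto elim: PU_cases)
  have "x \<in> bdry" "y \<in> bdry" using \<open>fixcl k \<subseteq> bdry\<close> assms(2) by auto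
  then obtain p q where p: "x = pt p" "p \<noteq> 0" "herm p p = 0" and q: "y = pt q" "q \<noteq> 0" "herm q q = 0"
    by (auto simp: bdry_def)
  have "herm p q \<noteq> 0"
  proof
    assume "herm p q = 0"
    then obtain c where c: "p = c *s q" using null_orthogonal_parallel p q by blast
    then have "c \<noteq> 0" using p by auto
    then show False using assms(3) c p q pt_eq_iff by blast
  qed
  with p q interpret np: null_pair p q by unfold_locales auto
  have "act k x = x" "act k y = y" using assms(2) by (auto simp: fixcl_def)
  then obtain l m where l: "A *v p = l *s p" and m: "A *v q = m *s q"
    using act_fixed_iff[OF A(1) p(2)] act_fixed_iff[OF A(1) q(2)] A(2) p(1) q(1) by blast
  have lm: "l * cnj m = 1" using eigenvalues_reciprocal[OF A(1) l m] by simp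
  have "cmod l \<noteq> 1"
  proof
    assume "cmod l = 1"
    then have "l * cnj l = l * cnj m" using lm by (simp flip: complex_norm_square)
    then have "cnj l = cnj m" using lm by (metis mult_left_cancel mult_zero_left zero_neq_one)
    then have "l = m" by simp
    \<comment> \<open>With equal multipliers every combination of \<open>p\<close> and
      \<open>q\<close> is an eigenvector; this positive one would be a fixed point inside hyperbolic
      space.\<close>
    let ?s = "p + herm p q *s q"
    have pos: "Re (herm ?s ?s) > 0" by (rule np.positive_combination)
    then have "?s \<noteq> 0" by auto
    have "A *v ?s = l *s ?s"
      by (simp add: matrix_vector_right_distrib matvec_scale l m \<open>l = m\<close> vector_add_ldistrib vector_smult_assoc mult.commute)
    then have "act k (pt ?s) = pt ?s" using act_fixed_iff[OF A(1) \<open>?s \<noteq> 0\<close>] A by blast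
    moreover have "pt ?s \<in> hyp" using pos by (auto simp: hyp_def)
    ultimately have "pt ?s \<in> {x, y}" using assms(2) by (auto simp: fixcl_def)
    then have "pt p \<in> hyp \<or> pt q \<in> hyp" using \<open>pt ?s \<in> hyp\<close> p q by auto
    then show False using pt_in_hypD[of p] pt_in_hypD[of q] by auto
  qed
  then consider "cmod l > 1" | "cmod l < 1" by linarith
  then show ?thesis
  proof cases
    case 1
    then have "lox p q A l m" using A l m by unfold_locales
    then show ?thesis using that A p q by blast
  next
    case 2
    have "cmod l * cmod m = 1" using arg_cong[OF lm, of cmod] by (simp add: norm_mult)
    moreover have "cmod l * cmod m \<le> cmod l * 1" if "cmod m \<le> 1"
      using that by (intro mult_left_mono) auto
    ultimately have "cmod m > 1" using 2 by fastforce
    then have "lox q p A m l" using A l m by unfold_locales auto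
    then show ?thesis using that A p q insert_commute[of x y "{}"] by simp
  qed
qed

text \<open>The full preimage in the matrix group, so it contains all unit scalars when
  \<open>K\<close> is a subgroup, as \<open>mdiscrete\<close> expects.\<close>

definition mats :: "('n::finite) pu set \<Rightarrow> 'n cmat set" where
  "mats K = {A \<in> U1n. cls A \<in> K}"

lemma pu_subgroup_hinv:
  assumes "pu_subgroup K" "cls A \<in> K" "A \<in> U1n"
  shows "cls (hinv A) \<in> K"
proof -
  obtain h where h: "h \<in> K" "pu_mult (cls A) h = pu_one" using assms by (auto simp: pu_subgroup_def)
  then have "h \<in> PU" using assms(1) by (auto simp: pu_subgroup_def)
  then obtain B where B: "B \<in> U1n" "h = cls B" by (rule PU_cases)
  then have "cls (A ** B) = cls (mat 1)" using h by (simp add: pu_mult_cls pu_one_def)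
  then obtain c where c: "cmod c = 1" "A ** B = mat c" by (auto simp: cls_eq_iff)
  then have "hinv A ** (A ** B) = mat c ** hinv A" by (simp add: mat_commute)
  then have "B = mat c ** hinv A" using assms(3) by simp
  then show ?thesis using h B c by (simp add: cls_scale)
qed

lemma mgroup_mats:
  assumes "pu_subgroup K"
  shows "mgroup (mats K)"
proof -
  have "cls (M ** N) \<in> K" if "cls M \<in> K" "cls N \<in> K" for M N
    using assms that unfolding pu_subgroup_def by (metis pu_mult_cls)
  then show ?thesis
    using assms pu_subgroup_hinv[OF assms] unfolding mgroup_def mats_def
    by (auto simp: pu_subgroup_def pu_one_def)
qed

section \<open>Quotient topology and discreteness\<close>

lemma openin_PU_top:
  fixes S :: "('n::finite) pu set"
  shows "openin PU_top S \<longleftrightarrow> S \<subseteq> PU \<and> openin (top_of_set U1n) (\<Union>S)"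
proof -
  have "istopology (\<lambda>S::'n pu set. S \<subseteq> PU \<and> openin (top_of_set U1n) (\<Union>S))"
    unfolding istopology_def
  proof (intro conjI allI impI)
    fix S T :: "'n pu set"
    assume S: "S \<subseteq> PU \<and> openin (top_of_set U1n) (\<Union> S)" and T: "T \<subseteq> PU \<and> openin (top_of_set U1n) (\<Union> T)"
    \<comment> \<open>Holds because classes are equal or disjoint.\<close>
    have "\<Union>(S \<inter> T) = \<Union>S \<inter> \<Union>T"
    proof
      show "\<Union> S \<inter> \<Union> T \<subseteq> \<Union> (S \<inter> T)"
      proof
        fix A assume "A \<in> \<Union>S \<inter> \<Union>T"
        then obtain g h where "g \<in> S" "A \<in> g" "h \<in> T" "A \<in> h" by blast
        then have "g = h" using S T PU_mem by (metis subsetD)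
        then show "A \<in> \<Union> (S \<inter> T)" using \<open>g \<in> S\<close> \<open>h \<in> T\<close> \<open>A \<in> g\<close> by blast
      qed
    qed blast
    then show "openin (top_of_set U1n) (\<Union> (S \<inter> T))" using S T by auto
  next
    fix \<K> :: "'n pu set set"
    assume *: "\<forall>K\<in>\<K>. K \<subseteq> PU \<and> openin (top_of_set U1n) (\<Union> K)"
    have "\<Union>(\<Union>\<K>) = \<Union>(Union ` \<K>)" by blast
    then show "openin (top_of_set U1n) (\<Union> (\<Union> \<K>))" using * by auto
  qed blast+
  then show ?thesis by (simp add: PU_top_def)
qed

lemma Union_PU: "\<Union>PU = U1n"
  using PU_mem cls_self cls_in_PU by blast

lemma topspace_PU_top: "topspace (PU_top :: 'n::finite pu topology) = PU"
proof
  show "topspace (PU_top :: 'n pu topology) \<subseteq> PU"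
    using openin_PU_top[THEN iffD1, OF openin_topspace] by (rule conjunct1)
  have "openin PU_top (PU :: 'n pu set)" by (simp add: openin_PU_top Union_PU)
  then show "PU \<subseteq> topspace (PU_top :: 'n pu topology)" by (rule openin_subset)
qed

lemma open_nbhd_ball:
  assumes "openin PU_top U" "cls A \<in> U" "A \<in> U1n"
  obtains e where "e > 0" "\<And>M. M \<in> U1n \<Longrightarrow> norm (M - A) < e \<Longrightarrow> cls M \<in> U"
proof -
  have "openin (top_of_set U1n) (\<Union>U)" "A \<in> \<Union>U" using assms cls_self by (auto simp: openin_PU_top)
  then obtain e where e: "e > 0" "ball A e \<inter> U1n \<subseteq> \<Union>U"
    by (meson openin_contains_ball)
  have "cls M \<in> U" if M: "M \<in> U1n" "norm (M - A) < e" for M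
  proof -
    have "M \<in> \<Union>U" using M e by (auto simp: dist_norm norm_minus_commute)
    then obtain g where "g \<in> U" "M \<in> g" by blast
    then show ?thesis using PU_mem assms(1) by (metis openin_PU_top subsetD)
  qed
  then show ?thesis using that e by blast
qed

text \<open>The quotient map is open: the saturation of a ball is the union of its translates by
  unit scalars.\<close>

lemma openin_cls_ball:
  fixes A :: "('n::finite) cmat"
  shows "openin PU_top (cls ` {B\<in>U1n. norm (B - A) < e})"
proof -
  have "\<Union>(cls ` {B\<in>U1n. norm (B - A) < e}) = U1n \<inter> (\<Union>c\<in>{c. cmod c = 1}. {M. norm (mat c ** M - A) < e})"
    (is "?L = ?R")
  proof
    show "?L \<subseteq> ?R"
    proof
      fix M assume "M \<in> ?L"
      then obtain B where B: "B \<in> U1n" "norm (B - A) < e" "M \<in> cls B" by blast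
      then have "cls B = cls M" using cls_mem by blast
      then obtain c where "cmod c = 1" "B = mat c ** M" using cls_eq_iff by blast
      moreover have "M \<in> U1n" using B PU_mem cls_in_PU by blast
      ultimately show "M \<in> ?R" using B by blast
    qed
    show "?R \<subseteq> ?L"
    proof
      fix M assume "M \<in> ?R"
      then obtain c where c: "M \<in> U1n" "cmod c = 1" "norm (mat c ** M - A) < e" by blast
      then have "M \<in> cls (mat c ** M)" using cls_scale cls_self by blast
      then show "M \<in> ?L" using c U1n_scale by blast
    qed
  qed
  moreover have "open {M. norm (mat c ** M - A) < e}" for c
  proof (rule open_Collect_less)
    have "linear (\<lambda>M. mat c ** M :: 'n cmat)"
      by (rule linearI)
        (auto simp: matrix_matrix_mult_def vec_eq_iff sum.distrib algebra_simps scaleR_sum_right)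
    then show "continuous_on UNIV (\<lambda>M. norm (mat c ** M - A))"
      by (intro continuous_intros linear_continuous_on) (simp add: linear_conv_bounded_linear)
  qed auto
  ultimately show ?thesis
    unfolding openin_PU_top by (auto intro!: openin_open_Int)
qed

text \<open>Left translation carries isolation of the identity to every other element; the radius at
  \<open>A\<close> shrinks with \<open>norm A\<close>, which also bounds the inverse.\<close>

lemma pu_discrete_iff:
  fixes K :: "('n::finite) pu set"
  assumes K: "pu_subgroup K"
  shows "pu_discrete K \<longleftrightarrow> mdiscrete (mats K)"
proof
  assume "pu_discrete K"
  have oneK: "pu_one \<in> K" using K by (simp add: pu_subgroup_def)
  have "openin (subtopology PU_top K) {pu_one}"
    using \<open>pu_discrete K\<close> oneK by (simp add: pu_discrete_def)
  then obtain U where U: "openin PU_top U" "{pu_one} = U \<inter> K" by (auto simp: openin_subtopology)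
  then obtain e where e: "e > 0" "\<And>M. M \<in> U1n \<Longrightarrow> norm (M - mat 1) < e \<Longrightarrow> cls M \<in> U"
    using open_nbhd_ball[OF U(1), of "mat 1"] by (auto simp: pu_one_def)
  have "\<exists>c. M = mat c" if "M \<in> mats K" "norm (M - mat 1) < e" for M
  proof -
    have "cls M \<in> U \<inter> K" using that e by (auto simp: mats_def)
    then have "cls M = cls (mat 1)" using U by (auto simp: pu_one_def)
    then show ?thesis by (auto simp: cls_eq_iff)
  qed
  then show "mdiscrete (mats K)" using e by (auto simp: mdiscrete_def)
next
  assume "mdiscrete (mats K)"
  then obtain e where e: "e > 0" "\<And>M. M \<in> mats K \<Longrightarrow> norm (M - mat 1) < e \<Longrightarrow> \<exists>c. M = mat c"
    by (auto simp: mdiscrete_def)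
  have KPU: "K \<subseteq> PU" using K by (simp add: pu_subgroup_def)
  obtain C where C: "C > 0" "\<And>(X::'n cmat) (Y::'n cmat). norm (X ** Y) \<le> C * norm X * norm Y"
    using norm_matmat_bound by blast
  have "openin (subtopology PU_top K) {g}" if "g \<in> K" for g
  proof -
    have "g \<in> PU" using that KPU by blast
    then obtain A where A: "A \<in> U1n" "g = cls A" by (rule PU_cases)
    define r where "r = e / (C * norm A + 1)"
    have pos: "C * norm A + 1 > 0" using C by (simp add: add_nonneg_pos)
    then have "r > 0" using e by (simp add: r_def)
    let ?U = "cls ` {B\<in>U1n. norm (B - A) < r}"
    have "?U \<inter> K = {g}"
    proof
      show "{g} \<subseteq> ?U \<inter> K" using A that \<open>r > 0\<close> by auto
      show "?U \<inter> K \<subseteq> {g}"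
      proof
        fix x assume "x \<in> ?U \<inter> K"
        then obtain B where B: "B \<in> U1n" "norm (B - A) < r" "x = cls B" "cls B \<in> K" by blast
        have "hinv A ** B \<in> mats K"
          using mgroup_mats[OF K] A B that by (intro mgroupD) (auto simp: mats_def)
        moreover have "norm (hinv A ** B - mat 1) < e"
        proof -
          have "hinv A ** B - mat 1 = hinv A ** (B - A)"
            using A by (simp add: matrix_diff_distrib_left hinv_left)
          then have "norm (hinv A ** B - mat 1) \<le> C * norm A * norm (B - A)"
            using C(2)[of "hinv A" "B - A"] by simp
          also have "\<dots> \<le> C * norm A * r" using B C by (intro mult_left_mono) auto
          also have "\<dots> < e" using pos e by (simp add: r_def field_simps)
          finally show ?thesis .
        qed
        ultimately obtain c where "hinv A ** B = mat c" using e by blast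
        then have "A ** (hinv A ** B) = mat c ** A" by (simp add: mat_commute)
        then have "B = mat c ** A" using A by simp
        moreover from this have "cmod c = 1" using scalar_multiple_U1n A B by blast
        ultimately show "x \<in> {g}" using A B cls_scale by simp
      qed
    qed
    then show ?thesis using openin_cls_ball[of A r] by (auto simp: openin_subtopology)
  qed
  then have "subtopology PU_top K = discrete_topology K"
    using KPU by (subst eq_commute, subst discrete_topology_unique) (auto simp: topspace_PU_top)
  then show "pu_discrete K" using KPU by (simp add: pu_discrete_def)
qed

lemma limitin_PU_one:
  fixes M :: "nat \<Rightarrow> ('n::finite) cmat"
  assumes "\<And>i. M i \<in> U1n" "\<And>i. norm (M i - mat 1) < inverse (Suc i)"
  shows "limitin PU_top (\<lambda>i. cls (M i)) pu_one sequentially"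
  unfolding limitin_def
proof (intro conjI allI impI)
  show "pu_one \<in> topspace PU_top" by (simp add: topspace_PU_top pu_one_def)
  fix U :: "'n pu set" assume U: "openin PU_top U \<and> pu_one \<in> U"
  then obtain e where e: "e > 0" "\<And>M. M \<in> U1n \<Longrightarrow> norm (M - mat 1) < e \<Longrightarrow> cls M \<in> U"
    using open_nbhd_ball[of U "mat 1"] by (auto simp: pu_one_def)
  have "\<forall>\<^sub>F i in sequentially. inverse (real (Suc i)) < e"
    using LIMSEQ_inverse_real_of_nat e(1) by (rule order_tendstoD)
  then show "\<forall>\<^sub>F i in sequentially. cls (M i) \<in> U"
    by (rule eventually_mono) (rule e(2)[OF assms(1) less_trans[OF assms(2)]])
qed

lemma gen2_subgroup:
  assumes "pu_subgroup G" "g \<in> G" "h \<in> G"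
  shows "pu_subgroup (gen2 g h)" "g \<in> gen2 g h" "h \<in> gen2 g h" "gen2 g h \<subseteq> G"
proof -
  show sub: "gen2 g h \<subseteq> G" using assms by (auto simp: gen2_def)
  show "g \<in> gen2 g h" "h \<in> gen2 g h" by (auto simp: gen2_def)
  have GPU: "G \<subseteq> PU" using assms by (simp add: pu_subgroup_def)
  have "\<exists>y\<in>gen2 g h. pu_mult x y = pu_one" if "x \<in> gen2 g h" for x
  proof -
    have "x \<in> PU" using that sub GPU by blast
    then obtain A where A: "A \<in> U1n" "x = cls A" by (rule PU_cases)
    have "cls (hinv A) \<in> K" if "pu_subgroup K" "g \<in> K" "h \<in> K" for K
      using \<open>x \<in> gen2 g h\<close> A that by (intro pu_subgroup_hinv) (auto simp: gen2_def)
    then have "cls (hinv A) \<in> gen2 g h" by (simp add: gen2_def)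
    moreover have "pu_mult x (cls (hinv A)) = pu_one"
      using A by (simp add: pu_mult_cls pu_one_def hinv_right)
    ultimately show ?thesis by blast
  qed
  moreover have "pu_mult x y \<in> gen2 g h" if "x \<in> gen2 g h" "y \<in> gen2 g h" for x y
  proof -
    have "pu_mult x y \<in> K" if "pu_subgroup K" "g \<in> K" "h \<in> K" for K
    proof -
      have "x \<in> K" "y \<in> K"
        using that \<open>x \<in> gen2 g h\<close> \<open>y \<in> gen2 g h\<close> by (simp_all add: gen2_def)
      then show ?thesis using \<open>pu_subgroup K\<close> unfolding pu_subgroup_def by blast
    qed
    then show ?thesis by (simp add: gen2_def)
  qed
  moreover have "pu_one \<in> gen2 g h"
    unfolding gen2_def pu_subgroup_def by blast
  ultimately show "pu_subgroup (gen2 g h)"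
    unfolding pu_subgroup_def using order_trans[OF sub GPU] by blast
qed

subsection \<open>The discreteness criterion\<close>

lemma lox_conj:
  assumes "lox p q A l m" "B \<in> U1n"
  shows "lox (B *v p) (B *v q) (B ** A ** hinv B) l m"
proof -
  interpret lox p q A l m by fact
  show ?thesis
    using assms(2) l_gt
    by unfold_locales (simp_all add: U1nD A_p A_q matvec_scale flip: matrix_vector_mul_assoc)
qed

lemma mats_iff: "A \<in> mats K \<longleftrightarrow> A \<in> U1n \<and> cls A \<in> K"
  by (simp add: mats_def)

context lox
begin

text \<open>The radius depends on \<open>A\<close> only, although the group assumed discrete varies
  with \<open>B\<close>.\<close>

lemma near_identity_fixes:
  assumes G: "pu_subgroup G" "cls A \<in> G"
  shows "\<exists>e>0. \<forall>B. B \<in> mats G \<longrightarrow> norm (B - mat 1) < e \<longrightarrow>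
    pu_discrete (gen2 (cls A) (cls (B ** A ** hinv B))) \<longrightarrow>
    (\<exists>b. B *v p = b *s p) \<and> (\<exists>b. B *v q = b *s q)"
proof -
  obtain d where d: "d > 0" "\<And>\<Gamma> a. mgroup \<Gamma> \<Longrightarrow> mdiscrete \<Gamma> \<Longrightarrow> A \<in> \<Gamma> \<Longrightarrow> a \<in> \<Gamma> \<Longrightarrow> norm (a - mat 1) < d \<Longrightarrow>
     (\<exists>b. a *v p = b *s p) \<and> (\<exists>b. a *v q = b *s q)"
    using small_elements_fix by blast
  obtain C where C: "C > 0" "\<And>(X::'n cmat) (Y::'n cmat). norm (X ** Y) \<le> C * norm X * norm Y"
    using norm_matmat_bound by blast
  obtain C1 where C1: "C1 > 0" "\<And>M x. norm ((M::'n cmat) *v x) \<le> C1 * norm M * norm x"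
    using norm_matvec_bound by blast
  define k where "k = C * (C * norm A * (2 * C * norm A)) * (norm (mat 1 :: 'n cmat) + 1) + 1"
  have "k > 0" using C by (simp add: k_def add_nonneg_pos)
  define k1 where "k1 = C1 * norm p * norm q"
  have "k1 > 0" using C1 by (simp add: k1_def)
  \<comment> \<open>The bound 1 controls \<open>norm B\<close>, \<open>d / k\<close> makes the
    commutator of \<open>A\<close> and \<open>B\<close> small enough for
    \<open>small_elements_fix\<close>, and the last bound prevents \<open>B\<close> from exchanging
    the lines of \<open>p\<close> and \<open>q\<close>.\<close>
  define e where "e = min (min 1 (d / k)) (cmod (herm p q) / k1)"
  have "e > 0" using d \<open>k > 0\<close> \<open>k1 > 0\<close> by (simp add: e_def)
  moreover have "(\<exists>b. B *v p = b *s p) \<and> (\<exists>b. B *v q = b *s q)"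
    if B: "B \<in> mats G" "norm (B - mat 1) < e" and disc: "pu_discrete (gen2 (cls A) (cls (B ** A ** hinv B)))" for B
  proof -
    have BU: "B \<in> U1n" using B by (simp add: mats_iff)
    let ?k = "B ** A ** hinv B"
    let ?a = "hinv A ** ?k"
    define \<Gamma> where "\<Gamma> = mats (gen2 (cls A) (cls ?k))"
    have "?k \<in> mats G"
      using mgroup_mats[OF G(1)] B(1) G(2) by (intro mgroupD) (auto simp: mats_iff)
    then have kG: "cls ?k \<in> G" by (simp add: mats_iff)
    have \<Gamma>: "mgroup \<Gamma>" "mdiscrete \<Gamma>"
      unfolding \<Gamma>_def using gen2_subgroup(1)[OF G kG] disc mgroup_mats pu_discrete_iff by blast+
    have A\<Gamma>: "A \<in> \<Gamma>" and k\<Gamma>: "?k \<in> \<Gamma>"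
      using gen2_subgroup(2,3)[OF G kG] BU by (auto simp: \<Gamma>_def mats_iff)
    have a\<Gamma>: "?a \<in> \<Gamma>" using \<Gamma>(1) A\<Gamma> k\<Gamma> mgroupD(3,4) by metis
    have "norm (?a - mat 1) < d"
    proof -
      let ?b = "norm (B - mat 1)"
      let ?Y = "(B - mat 1) ** A - A ** (B - mat 1)"
      have "?Y = B ** A - A ** B"
        by (simp add: matrix_diff_distrib_left matrix_diff_distrib_right)
      then have "hinv A ** ?Y ** hinv B = ?a - mat 1"
        using BU by (simp add: matrix_diff_distrib_left matrix_diff_distrib_right hinv_right flip: matrix_mul_assoc)
      then have "norm (?a - mat 1) = norm (hinv A ** ?Y ** hinv B)" by simp
      also have "\<dots> \<le> C * norm (hinv A ** ?Y) * norm (hinv B)" by (rule C(2))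
      also have "\<dots> \<le> C * (C * norm A * norm ?Y) * norm (hinv B)"
        using C(2)[of "hinv A" ?Y] C(1) by (intro mult_right_mono mult_left_mono) auto
      also have "\<dots> \<le> C * (C * norm A * (2 * C * norm A * ?b)) * (norm (mat 1 :: 'n cmat) + 1)"
      proof (intro mult_mono mult_left_mono)
        have "norm ?Y \<le> C * ?b * norm A + C * norm A * ?b"
          by (rule norm_triangle_le_diff[OF add_mono]) (rule C(2))+
        then show "norm ?Y \<le> 2 * C * norm A * ?b" by (simp add: algebra_simps)
        have "norm B \<le> norm (mat 1 :: 'n cmat) + ?b"
          using norm_triangle_ineq[of "mat 1" "B - mat 1"] by simp
        then show "norm (hinv B) \<le> norm (mat 1 :: 'n cmat) + 1"
          using B(2) by (simp add: e_def)
      qed (use C in auto)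
      also have "\<dots> = (k - 1) * ?b" by (simp add: k_def)
      also have "\<dots> \<le> k * ?b" by (rule mult_right_mono) auto
      also have "\<dots> < d"
      proof -
        have "?b < d / k" using B(2) by (simp add: e_def)
        then show ?thesis using \<open>k > 0\<close> by (simp add: field_simps)
      qed
      finally show ?thesis .
    qed
    then obtain b c where bc: "?a *v p = b *s p" "?a *v q = c *s q"
      using d(2)[OF \<Gamma> A\<Gamma> a\<Gamma>] by blast
    have eig: "A *v (hinv B *v v) = (b' * x) *s (hinv B *v v)"
      if "?a *v v = b' *s v" "A *v v = x *s v" for v b' x
    proof -
      have "A *v (?a *v v) = (b' * x) *s v"
        using that by (simp add: matvec_scale vector_smult_assoc)
      then have "B *v (A *v (hinv B *v v)) = (b' * x) *s v"
        by (simp flip: matrix_vector_mul_assoc)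
      then have "hinv B *v (B *v (A *v (hinv B *v v))) = hinv B *v ((b' * x) *s v)" by simp
      then show ?thesis using BU by (simp add: matvec_scale)
    qed
    have small: "cmod (herm u ((B - mat 1) *v v)) < cmod (herm p q)" if "norm u * norm v = norm p * norm q" for u v
    proof -
      have "cmod (herm u ((B - mat 1) *v v)) \<le> norm u * norm ((B - mat 1) *v v)" by (rule norm_herm_le)
      also have "\<dots> \<le> norm u * (C1 * norm (B - mat 1) * norm v)"
        by (intro mult_left_mono C1(2)) auto
      also have "\<dots> = C1 * norm (B - mat 1) * (norm u * norm v)" by (simp add: mult_ac)
      also have "\<dots> = norm (B - mat 1) * k1" by (simp only: that) (simp add: k1_def mult_ac)
      also have "\<dots> < cmod (herm p q)"
      proof -
        have "norm (B - mat 1) < cmod (herm p q) / k1" using B(2) by (simp add: e_def)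
        then show ?thesis using \<open>k1 > 0\<close> by (simp add: field_simps)
      qed
      finally show ?thesis .
    qed
    have near: "herm u (B *v v) \<noteq> 0" if "norm u * norm v = norm p * norm q" "cmod (herm u v) = cmod (herm p q)" for u v
    proof
      assume "herm u (B *v v) = 0"
      moreover have "B *v v = v + (B - mat 1) *v v" by (simp add: matrix_vector_mult_diff_rdistrib)
      ultimately have "herm u v + herm u ((B - mat 1) *v v) = 0" by (simp add: herm_add_right)
      then have "herm u ((B - mat 1) *v v) = - herm u v" by (simp add: add_eq_0_iff)
      then show False using small[OF that(1)] that(2) by simp
    qed
    have cqp: "cmod (herm q p) = cmod (herm p q)" by (metis cnj_herm complex_mod_cnj)
    have fix_of: "\<exists>b. B *v v = b *s v" if v: "hinv B *v v = c' *s v" "v \<noteq> 0" for v c'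
    proof -
      have "B *v v = inverse c' *s v"
        using hinv_eigen(2)[OF U1n_hinv[OF BU] v] by simp
      then show ?thesis by blast
    qed
    \<comment> \<open>An exchange would make \<open>herm u (B *v v)\<close> vanish, but for
      \<open>B\<close> near the identity it is close to \<open>herm u v\<close>.\<close>
    have no_swap: False if "hinv B *v u = c' *s v" "herm v v = 0"
      "norm u * norm v = norm p * norm q" "cmod (herm u v) = cmod (herm p q)" for u v c'
    proof -
      have "u = c' *s (B *v v)" using arg_cong[OF that(1), of "(*v) B"] BU by (simp add: matvec_scale)
      then have "herm u (B *v v) = c' * herm v v" by (simp add: herm_scale_left U1nD[OF BU])
      then show False using near[OF that(3,4)] that(2) by simp
    qed
    have "\<exists>b. B *v p = b *s p"
    proof (rule eigen_cases[OF eig[OF bc(1) A_p]])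
      show "0 \<le> Re (herm (hinv B *v p) (hinv B *v p))" using BU by (simp add: U1nD)
    next
      fix c' assume "hinv B *v p = c' *s p"
      then show ?thesis using fix_of by simp
    next
      fix c' assume "hinv B *v p = c' *s q"
      then have False using no_swap[of p c' q] by simp
      then show ?thesis ..
    qed
    moreover have "\<exists>b. B *v q = b *s q"
    proof (rule eigen_cases[OF eig[OF bc(2) A_q]])
      show "0 \<le> Re (herm (hinv B *v q) (hinv B *v q))" using BU by (simp add: U1nD)
    next
      fix c' assume "hinv B *v q = c' *s q"
      then show ?thesis using fix_of by simp
    next
      fix c' assume "hinv B *v q = c' *s p"
      then have False using no_swap[of q c' p] cqp by simp
      then show ?thesis ..
    qed
    ultimately show ?thesis ..
  qed
  ultimately show ?thesis by blast
qed

text \<open>A common multiplier at \<open>p\<close> and \<open>q\<close> has modulus 1, and on the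
  definite complement \<open>B\<close> acts isometrically, so its powers are bounded and two of them
  agree up to a scalar. \<open>A ** B\<close> is the second generator since it can be loxodromic
  where \<open>B\<close> is not.\<close>

lemma finite_order_of_fixing:
  assumes G: "pu_subgroup G" "cls A \<in> G" "cls B \<in> G" and B: "B \<in> U1n" "B *v p = b *s p" "B *v q = b *s q"
    and disc: "pu_discrete (gen2 (cls A) (cls (A ** B)))"
  shows "finite_order (cls B)"
proof -
  let ?G = "mats (gen2 (cls A) (cls (A ** B)))"
  have "cls (A ** B) \<in> G" using G unfolding pu_subgroup_def by (metis pu_mult_cls)
  note g = gen2_subgroup[OF G(1,2) this]
  have \<Gamma>: "mgroup ?G" "mdiscrete ?G" using g(1) disc mgroup_mats pu_discrete_iff by blast+
  have AG: "A \<in> ?G" "A ** B \<in> ?G" using g(2,3) B(1) by (auto simp: mats_iff)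
  have "hinv A ** (A ** B) \<in> ?G"
    by (rule mgroupD(3)[OF \<Gamma>(1) mgroupD(4)[OF \<Gamma>(1) AG(1)] AG(2)])
  then have BG: "B \<in> ?G" by simp
  have "b * cnj b = 1" using eigenvalues_reciprocal[OF B(1,2,3)] by simp
    then have b1: "cmod b = 1" by (rule cmod_eq_1)
  obtain C where C: "C > 0" "\<And>w. herm w p = 0 \<Longrightarrow> herm w q = 0 \<Longrightarrow> (norm w)\<^sup>2 \<le> C * (- Re (herm w w))"
    using perp_bound by blast
  have "\<exists>K. \<forall>j. norm (mpow B j *v v) \<le> K" for v
  proof -
    obtain s t w where v: "v = s *s p + t *s q + w" and w: "herm w p = 0" "herm w q = 0"
      by (rule decomp)
    have "norm (mpow B j *v v) \<le> norm (s *s p) + norm (t *s q) + sqrt (C * (- Re (herm w w)))" for j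
    proof -
      let ?w = "mpow B j *v w"
      have U: "mpow B j \<in> U1n" using B by simp
      have e: "mpow B j *v p = b ^ j *s p" "mpow B j *v q = b ^ j *s q"
        using B mpow_eigen by auto
      then have "hinv (mpow B j) *v p = inverse (b ^ j) *s p" "hinv (mpow B j) *v q = inverse (b ^ j) *s q"
        using hinv_eigen(2)[OF U] by auto
      then have "herm ?w p = 0" "herm ?w q = 0" using w by (simp_all add: herm_move[OF U] herm_simps)
      then have "(norm ?w)\<^sup>2 \<le> C * (- Re (herm w w))" using C(2)[of ?w] by (simp add: U1nD[OF U])
      then have nw: "norm ?w \<le> sqrt (C * (- Re (herm w w)))" by (rule real_le_rsqrt)
      have "norm (mpow B j *v v) \<le> norm (s *s (b ^ j *s p)) + norm (t *s (b ^ j *s q)) + norm ?w"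
        unfolding v matrix_vector_right_distrib matvec_scale e
        by (intro norm_triangle_le add_mono norm_triangle_ineq order_refl)
      also have "\<dots> = norm (s *s p) + norm (t *s q) + norm ?w"
        unfolding norm_scale by (simp add: norm_power b1)
      finally show ?thesis using nw by linarith
    qed
    then show ?thesis by blast
  qed
  then obtain K where K: "\<And>j. norm (mpow B j) \<le> K"
    using bounded_of_pointwise[of "mpow B"] by blast
  obtain i j c where ij: "i < j" "mpow B j = mat c ** mpow B i"
    using discrete_bounded_repeat[OF \<Gamma>, of "mpow B" K] K mgroup_mpow[OF \<Gamma>(1) BG] by blast
  define r where "r = j - i"
  have r: "r > 0" "j = i + r" using ij by (auto simp: r_def)
  have "mpow B i ** mpow B r = mpow B i ** mat c"
    using ij by (simp add: r mpow_add mat_commute)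
  then have "hinv (mpow B i) ** (mpow B i ** mpow B r) = hinv (mpow B i) ** (mpow B i ** mat c)" by simp
  then have rc: "mpow B r = mat c ** mat 1" using B(1) by simp
  then have "cmod c = 1" using scalar_multiple_U1n[of "mat 1" c] B(1) by (metis U1n_one mpow_U1n)
  then have "pu_pow (cls B) r = pu_one" unfolding pu_pow_cls rc pu_one_def by (rule cls_scale)
  then show ?thesis using r(1) by (auto simp: finite_order_def)
qed

end

section \<open>Elements exchanging or fixing a pair of boundary points\<close>

context null_pair
begin

lemma swap_elliptic:
  assumes B: "B \<in> U1n" "B *v p = a *s q" "B *v q = b *s p"
  shows "elliptic (cls B)"
proof -
  let ?H = "herm p q"
  have H: "a * cnj b * cnj ?H = ?H"
    using U1nD[OF B(1), of p q] by (simp add: B herm_simps cnj_herm mult_ac)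
  then have b: "b \<noteq> 0" by auto
  \<comment> \<open>For \<open>p + t q\<close> to be an eigenvector, \<open>t * t * b = a\<close> is
    needed, which fixes \<open>t\<close> up to sign. The phase of \<open>?H\<close> picks the root
    for which the vector is positive.\<close>
  define t where "t = ?H / of_real (cmod ?H * cmod b)"
  have nH: "of_real (cmod ?H) \<noteq> (0::complex)" "of_real (cmod b) \<noteq> (0::complex)" using b by auto
  have sq: "of_real (cmod ?H) * of_real (cmod ?H) = ?H * cnj ?H" "of_real (cmod b) * of_real (cmod b) = b * cnj b"
    using complex_norm_square[of ?H] complex_norm_square[of b] by (simp_all add: power2_eq_square)
  have "t * t * b = (?H * ?H * b) / ((of_real (cmod ?H) * of_real (cmod ?H)) * (of_real (cmod b) * of_real (cmod b)))"
    by (simp add: t_def)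
  also have "\<dots> = ?H / (cnj ?H * cnj b)" using b unfolding sq by simp
  also have "\<dots> = a" using H b by (simp add: field_simps)
  finally have tt: "t * t * b = a" .
  define s where "s = p + t *s q"
  have "B *v s = (t * b) *s s"
    by (simp add: s_def matrix_vector_right_distrib matvec_scale B vector_add_ldistrib vector_smult_assoc add.commute mult_ac)
       (use tt in \<open>simp add: mult_ac\<close>)
  have ct: "cnj t * ?H = of_real (cmod ?H / cmod b)"
  proof -
    have "cnj t * ?H = (?H * cnj ?H) / of_real (cmod ?H * cmod b)" by (simp add: t_def mult.commute)
    also have "\<dots> = of_real (cmod ?H / cmod b)" using nH unfolding sq(1)[symmetric] by (simp add: field_simps)
    finally show ?thesis .
  qed
  have "herm s s = cnj t * ?H + cnj (cnj t * ?H)"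
    by (simp add: s_def herm_simps cnj_herm)
  then have "Re (herm s s) = 2 * (cmod ?H / cmod b)" unfolding ct by simp
  moreover have "\<dots> > 0" using b by simp
  ultimately have pos: "Re (herm s s) > 0" by linarith
  then have "s \<noteq> 0" by auto
  have "pt s \<in> hyp" using pos by (auto simp: hyp_def)
  moreover have "act (cls B) (pt s) = pt s"
    using act_fixed_iff[OF B(1) \<open>s \<noteq> 0\<close>] \<open>B *v s = (t * b) *s s\<close> by blast
  moreover have "cls B \<noteq> pu_one"
  proof
    assume "cls B = pu_one"
    then obtain c where c: "cmod c = 1" "B = mat c" by (auto simp: pu_one_def cls_eq_iff)
    then have "c *s p = a *s q" using B by (simp add: mat_vec)
    then have "c * herm p q = a * herm q q" by (metis herm_scale_left)
    then show False using c by auto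
  qed
  ultimately show ?thesis using B(1) by (auto simp: elliptic_def)
qed

text \<open>If all of \<open>G\<close> preserved the pair, a non-elliptic element could not exchange
  its members, so it would fix \<open>p\<close>; the two elements witnessing non-elementarity would
  share a fixed point.\<close>

lemma exists_mover:
  assumes "pu_subgroup G" "non_elementary G"
  shows "\<exists>C\<in>mats G. pt (C *v p) \<notin> {pt p, pt q} \<or> pt (C *v q) \<notin> {pt p, pt q}"
proof (rule ccontr)
  assume "\<not> ?thesis"
  then have *: "pt (C *v p) \<in> {pt p, pt q}" "pt (C *v q) \<in> {pt p, pt q}" if "C \<in> mats G" for C
    using that by blast+
  have "pt p \<in> fixset g" if "g \<in> G" "\<not> elliptic g" for g
  proof -
    have "g \<in> PU" using that assms by (auto simp: pu_subgroup_def)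
    then obtain B where B: "B \<in> U1n" "g = cls B" by (rule PU_cases)
    then have BG: "B \<in> mats G" using that by (simp add: mats_iff)
    show ?thesis
    proof (cases "pt (B *v p) = pt p")
      case True
      then show ?thesis using B fixset_iff[OF B(1) p_nz null_p] pt_eq_iff by blast
    next
      case False
      then have "pt (B *v p) = pt q" using *(1)[OF BG] by simp
      then obtain a where a: "B *v p = a *s q" using pt_eq_iff by blast
      have "pt (B *v q) = pt p"
      proof (rule ccontr)
        assume "pt (B *v q) \<noteq> pt p"
        then have "pt (B *v q) = pt q" using *(2)[OF BG] by simp
        then obtain b where "B *v q = b *s q" using pt_eq_iff by blast
        then have "herm p q = a * cnj b * herm q q"
          using U1nD[OF B(1), of p q] a by (simp add: herm_simps)
        then show False by simp
      qed
      then obtain b where "B *v q = b *s p" using pt_eq_iff by blast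
      then show ?thesis using swap_elliptic[OF B(1) a] that B by blast
    qed
  qed
  then show False using assms(2) unfolding non_elementary_def by blast
qed

lemma equal_multipliers:
  assumes B: "B \<in> U1n" "B *v p = b *s p" "B *v q = c *s q" "B *v r = d *s r"
    and "herm p r \<noteq> 0" "herm q r \<noteq> 0"
  shows "b = c"
proof -
  have 1: "b * cnj c = 1" "b * cnj d = 1" "c * cnj d = 1"
    using eigenvalues_reciprocal[OF B(1)] B(2-4) assms(5,6) herm_pq by blast+
  then have "cnj d \<noteq> 0" by auto
  then show ?thesis using 1(2,3) by (metis mult_right_cancel)
qed

lemma infinite_fixset:
  assumes B: "B \<in> U1n" "B *v p = b *s p" "B *v q = b *s q"
  shows "infinite (fixset (cls B))"
proof -
  let ?H = "herm p q"
  \<comment> \<open>The imaginary factor cancels the two cross terms, so these vectors are null.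
    Their pairing with \<open>q\<close> is constantly \<open>?H\<close>, which makes the points
    distinct.\<close>
  define v where "v s = p + (\<i> * of_nat s * ?H) *s q" for s :: nat
  have q: "herm (v s) q = ?H" for s by (simp add: v_def herm_simps)
  then have nz: "v s \<noteq> 0" for s using herm_pq herm_zero_left by metis
  have null: "herm (v s) (v s) = 0" for s
    by (simp add: v_def herm_simps cnj_herm[of p q, symmetric])
  have "B *v v s = b *s v s" for s
    by (simp add: v_def matrix_vector_right_distrib matvec_scale B vector_add_ldistrib vector_smult_assoc mult.commute)
  then have "pt (v s) \<in> fixset (cls B)" for s using fixset_iff[OF B(1) nz null] by blast
  then have "range (\<lambda>s. pt (v s)) \<subseteq> fixset (cls B)" by blast
  moreover have "inj (\<lambda>s. pt (v s))"
  proof (rule injI)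
    fix s t assume "pt (v s) = pt (v t)"
    then obtain c where c: "v s = c *s v t" using pt_eq_iff by blast
    then have "?H = c * ?H" using q herm_scale_left by metis
    then have "c = 1" by simp
    then have "herm (v s) p = herm (v t) p" using c by simp
    then show "s = t" by (simp add: v_def herm_simps)
  qed
  ultimately show ?thesis using range_inj_infinite infinite_super by blast
qed

end

text \<open>Unit scalars preserve the modulus of an off-diagonal entry and of a difference of
  diagonal entries, and one of these is nonzero for a nonscalar matrix.\<close>

lemma nonscalar_class_far:
  fixes B :: "('n::finite) cmat"
  assumes "\<nexists>c. B = mat c"
  obtains r where "r > 0" "\<And>M. M \<in> cls B \<Longrightarrow> r \<le> norm (M - mat 1)"
proof -
  have entry: "cmod (c * B $ i $ j - mat 1 $ i $ j) \<le> norm (mat c ** B - mat 1)" for c i j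
  proof -
    have "c * B $ i $ j = (mat c ** B) $ i $ j"
      by (simp add: matrix_matrix_mult_def mat_def if_distrib if_distribR cong: if_cong)
    then have "cmod (c * B $ i $ j - mat 1 $ i $ j) = norm ((mat c ** B - mat 1) $ i $ j)"
      by (simp only: vector_minus_component)
    also have "\<dots> \<le> norm ((mat c ** B - mat 1) $ i)"
      by (rule Finite_Cartesian_Product.norm_nth_le)
    also have "\<dots> \<le> norm (mat c ** B - mat 1)"
      by (rule Finite_Cartesian_Product.norm_nth_le)
    finally show ?thesis .
  qed
  show ?thesis
  proof (cases "\<exists>i j. i \<noteq> j \<and> B $ i $ j \<noteq> 0")
    case True
    then obtain i j where ij: "i \<noteq> j" "B $ i $ j \<noteq> 0" by blast
    show ?thesis
    proof (rule that)
      show "cmod (B $ i $ j) > 0" using ij by simp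
      fix M assume "M \<in> cls B"
      then obtain c where c: "cmod c = 1" "M = mat c ** B" by (auto simp: cls_def)
      show "cmod (B $ i $ j) \<le> norm (M - mat 1)"
        using entry[of c i j] ij(1) by (simp add: c(2)) (simp add: mat_def norm_mult c(1))
    qed
  next
    case False
    have "\<exists>i. B $ i $ i \<noteq> B $ None $ None"
    proof (rule ccontr)
      assume "\<not> ?thesis"
      then have "B $ i $ j = mat (B $ None $ None) $ i $ j" for i j
        using False \<open>\<not> (\<exists>i. B $ i $ i \<noteq> B $ None $ None)\<close> by (cases "i = j") (auto simp: mat_def)
      then have "B = mat (B $ None $ None)" unfolding vec_eq_iff by (intro allI)
      then have "\<exists>c. B = mat c" by (rule exI)
      with assms show False by (rule notE)
    qed
    then obtain i where i: "B $ i $ i \<noteq> B $ None $ None" by blast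
    show ?thesis
    proof (rule that)
      show "cmod (B $ i $ i - B $ None $ None) / 2 > 0" using i by simp
      fix M assume "M \<in> cls B"
      then obtain c where c: "cmod c = 1" "M = mat c ** B" by (auto simp: cls_def)
      have "(c * B $ i $ i - 1) - (c * B $ None $ None - 1) = c * (B $ i $ i - B $ None $ None)"
        by (simp add: algebra_simps)
      then have "cmod (B $ i $ i - B $ None $ None) = cmod ((c * B $ i $ i - 1) - (c * B $ None $ None - 1))"
        by (simp only: norm_mult c(1) mult_1)
      also have "\<dots> \<le> norm (M - mat 1) + norm (M - mat 1)"
      proof (rule norm_triangle_le_diff[OF add_mono])
        show "cmod (c * B $ i $ i - 1) \<le> norm (M - mat 1)" using entry[of c i i] c(2) by (simp add: mat_def)
        show "cmod (c * B $ None $ None - 1) \<le> norm (M - mat 1)" using entry[of c None None] c(2) by (simp add: mat_def)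
      qed
      finally show "cmod (B $ i $ i - B $ None $ None) / 2 \<le> norm (M - mat 1)" by simp
    qed
  qed
qed

text \<open>Each new matrix is closer to the identity than all representatives of the previous
  class, so no later term can return to an earlier class.\<close>

lemma distinct_classes_sequence:
  fixes Q :: "('n::finite) cmat set"
  assumes "\<And>e. e > 0 \<Longrightarrow> \<exists>B\<in>Q. norm (B - mat 1) < e" "\<And>B. B \<in> Q \<Longrightarrow> \<nexists>c. B = mat c"
  obtains f :: "nat \<Rightarrow> 'n cmat" where "\<And>i. f i \<in> Q" "\<And>i. norm (f i - mat 1) < inverse (Suc i)" "inj (\<lambda>i. cls (f i))"
proof -
  have "\<exists>f. \<forall>i. (f i \<in> Q \<and> norm (f i - mat 1) < inverse (Suc i)) \<and>
    (\<forall>M\<in>cls (f i). norm (f (Suc i) - mat 1) < norm (M - mat 1))"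
  proof (rule dependent_nat_choice)
    show "\<exists>B. B \<in> Q \<and> norm (B - mat 1) < inverse (real (Suc 0))" using assms(1)[of 1] by auto
  next
    fix B i assume "B \<in> Q \<and> norm (B - mat 1) < inverse (real (Suc i))"
    then obtain r where r: "r > 0" "\<And>M. M \<in> cls B \<Longrightarrow> r \<le> norm (M - mat 1)"
      using nonscalar_class_far[OF assms(2)] by metis
    obtain B' where B': "B' \<in> Q" "norm (B' - mat 1) < min r (inverse (Suc (Suc i)))"
      using assms(1)[of "min r (inverse (Suc (Suc i)))"] r(1) by auto
    then have "\<forall>M\<in>cls B. norm (B' - mat 1) < norm (M - mat 1)"
      using r(2) less_le_trans by simp blast
    then show "\<exists>B'. (B' \<in> Q \<and> norm (B' - mat 1) < inverse (real (Suc (Suc i)))) \<and>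
        (\<forall>M\<in>cls B. norm (B' - mat 1) < norm (M - mat 1))"
      using B' by auto
  qed
  then obtain f where f: "\<And>i. f i \<in> Q" "\<And>i. norm (f i - mat 1) < inverse (Suc i)"
    "\<And>i M. M \<in> cls (f i) \<Longrightarrow> norm (f (Suc i) - mat 1) < norm (M - mat 1)"
    by blast
  have mono: "norm (f j - mat 1) \<le> norm (f i - mat 1)" if "i \<le> j" for i j
    by (rule lift_Suc_antimono_le[OF _ that]) (rule less_imp_le[OF f(3)[OF cls_self]])
  have ne: "cls (f i) \<noteq> cls (f j)" if "i < j" for i j
  proof
    assume "cls (f i) = cls (f j)"
    then have "norm (f (Suc i) - mat 1) < norm (f j - mat 1)" using f(3) cls_self by metis
    then show False using mono[of "Suc i" j] that by simp
  qed
  have "inj (\<lambda>i. cls (f i))"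
    using ne by (rule linorder_injI)
  then show ?thesis using that f by blast
qed

theorem theorem3p4:
  fixes G :: "('n::finite) pu set" and h :: "'n pu" and x0 y0 :: "'n pt"
  assumes "pu_subgroup G"
    and "non_elementary G"
    and "h \<in> G" and "loxodromic h"
    and "x0 \<noteq> y0" and "fixcl h = {x0, y0}"
  shows "pu_discrete G \<longleftrightarrow>
           (condition_A (Gxy G x0 y0) \<and>
            (\<forall>g1\<in>G. \<forall>g2\<in>G. loxodromic g1 \<and> loxodromic g2 \<longrightarrow> pu_discrete (gen2 g1 g2)))"
proof (intro iffI conjI ballI impI)
  assume G: "pu_discrete G"
  show "condition_A (Gxy G x0 y0)"
    unfolding condition_A_def
  proof clarify
    fix gs :: "nat \<Rightarrow> 'n pu"
    assume gs: "inj gs" "\<forall>i. gs i \<in> Gxy G x0 y0 \<and> finite_order (gs i) \<and> infinite (fixset (gs i))"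
      "limitin PU_top gs pu_one sequentially"
    have "pu_one \<in> G" using assms(1) by (simp add: pu_subgroup_def)
    then have "openin (subtopology PU_top G) {pu_one}" using G by (simp add: pu_discrete_def)
    then obtain U where U: "openin PU_top U" "{pu_one} = U \<inter> G" by (auto simp: openin_subtopology)
    then have "\<forall>\<^sub>F i in sequentially. gs i \<in> U" using gs(3) by (auto simp: limitin_def)
    then obtain N where "\<And>i. i \<ge> N \<Longrightarrow> gs i \<in> U" by (auto simp: eventually_sequentially)
    then have "gs N \<in> U \<inter> G" "gs (Suc N) \<in> U \<inter> G" using gs(2) by (auto simp: Gxy_def)
    then have "gs N = gs (Suc N)" unfolding U(2)[symmetric] by simp
    then show False using gs(1) by (simp add: inj_eq)
  qed
  fix g1 g2 assume g: "g1 \<in> G" "g2 \<in> G"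
  note g' = gen2_subgroup[OF assms(1) g]
  have "mats (gen2 g1 g2) \<subseteq> mats G" using g'(4) by (auto simp: mats_def)
  then have "mdiscrete (mats (gen2 g1 g2))"
    using G pu_discrete_iff[OF assms(1)] unfolding mdiscrete_def by blast
  then show "pu_discrete (gen2 g1 g2)" using pu_discrete_iff[OF g'(1)] by blast
next
  assume "condition_A (Gxy G x0 y0) \<and>
    (\<forall>g1\<in>G. \<forall>g2\<in>G. loxodromic g1 \<and> loxodromic g2 \<longrightarrow> pu_discrete (gen2 g1 g2))"
  then have condA: "condition_A (Gxy G x0 y0)"
    and two: "\<And>g1 g2. g1 \<in> G \<Longrightarrow> g2 \<in> G \<Longrightarrow> loxodromic g1 \<Longrightarrow> loxodromic g2 \<Longrightarrow> pu_discrete (gen2 g1 g2)"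
    by blast+
  obtain A p q l m where L: "lox p q A l m" and h: "h = cls A" and xy: "{x0, y0} = {pt p, pt q}"
    using loxodromic_cases[OF assms(4,6,5)] by metis
  interpret lox p q A l m by fact
  note mg = mgroup_mats[OF assms(1)]
  have AG: "A \<in> mats G" using assms(3) h by (simp add: mats_iff)
  obtain C where C: "C \<in> mats G" "pt (C *v p) \<notin> {pt p, pt q} \<or> pt (C *v q) \<notin> {pt p, pt q}"
    using exists_mover[OF assms(1,2)] by blast
  have CU: "C \<in> U1n" using C by (simp add: mats_iff)
  let ?A' = "C ** A ** hinv C"
  have conjG: "B ** M ** hinv B \<in> mats G" if "B \<in> mats G" "M \<in> mats G" for B M
    using that mg mgroupD(3,4) by metis
  have L': "lox (C *v p) (C *v q) ?A' l m" using lox_conj[OF L CU] .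
  obtain r where r: "r = C *v p \<or> r = C *v q" "pt r \<notin> {pt p, pt q}" using C by blast
  then have "r \<noteq> 0" "herm r r = 0"
    using null_pair.p_nz[OF lox.axioms(1)[OF L']] null_pair.q_nz[OF lox.axioms(1)[OF L']] by (auto simp: U1nD[OF CU])
  \<comment> \<open>Distinct null lines are never orthogonal; these pairings are what transfers the
    multiplier at \<open>r\<close> to \<open>p\<close> and \<open>q\<close>.\<close>
  have herm_r: "herm v r \<noteq> 0" if "v = p \<or> v = q" for v
  proof
    assume "herm v r = 0"
    then have "herm r v = 0" using herm_eq_0_commute by blast
    moreover have "herm v v = 0" "v \<noteq> 0" using that by auto
    ultimately obtain c where c: "r = c *s v"
      using null_orthogonal_parallel[of v r] \<open>herm r r = 0\<close> by blast
    then have "c \<noteq> 0" using \<open>r \<noteq> 0\<close> by auto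
    then have "pt r = pt v" using c pt_eq_iff by blast
    then show False using r(2) that by blast
  qed
  obtain e1 where e1: "e1 > 0" "\<And>B. B \<in> mats G \<Longrightarrow> norm (B - mat 1) < e1 \<Longrightarrow>
      pu_discrete (gen2 (cls A) (cls (B ** A ** hinv B))) \<Longrightarrow>
      (\<exists>b. B *v p = b *s p) \<and> (\<exists>b. B *v q = b *s q)"
    using near_identity_fixes[OF assms(1)] AG mats_iff by metis
  obtain e2 where e2: "e2 > 0" "\<And>B. B \<in> mats G \<Longrightarrow> norm (B - mat 1) < e2 \<Longrightarrow>
      pu_discrete (gen2 (cls ?A') (cls (B ** ?A' ** hinv B))) \<Longrightarrow>
      (\<exists>b. B *v (C *v p) = b *s (C *v p)) \<and> (\<exists>b. B *v (C *v q) = b *s (C *v q))"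
    using lox.near_identity_fixes[OF L' assms(1)] conjG[OF C(1) AG] mats_iff by metis
  \<comment> \<open>Candidates for a violation of Condition A; leaving out scalar matrices allows
    distinct classes to be selected.\<close>
  define Q where "Q = {B \<in> mats G. (\<nexists>c. B = mat c) \<and> {pt p, pt q} \<subseteq> fixset (cls B) \<and>
    finite_order (cls B) \<and> infinite (fixset (cls B))}"
  show "pu_discrete G"
  proof (rule ccontr)
    assume "\<not> pu_discrete G"
    then have nd: "\<exists>B\<in>mats G. norm (B - mat 1) < e \<and> (\<nexists>c. B = mat c)" if "e > 0" for e
      using that pu_discrete_iff[OF assms(1)] unfolding mdiscrete_def by blast
    have "\<exists>B\<in>Q. norm (B - mat 1) < e" if e: "e > 0" for e
    proof -
      have "min e (min e1 e2) > 0" using e e1(1) e2(1) by simp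
      from nd[OF this] obtain B where B: "B \<in> mats G" "norm (B - mat 1) < min e (min e1 e2)" "\<nexists>c. B = mat c"
        by blast
      have BU: "B \<in> U1n" using B by (simp add: mats_iff)
      have disc: "pu_discrete (gen2 (cls M) (cls N))"
        if "M \<in> mats G" "N \<in> mats G" "lox p' q' M l' m'" "lox p'' q'' N l'' m''"
        for M N :: "'n cmat" and p' q' l' m' p'' q'' l'' m''
        using that by (intro two lox.loxodromic_cls[OF that(3)] lox.loxodromic_cls[OF that(4)]) (auto simp: mats_iff)
      obtain b c where bc: "B *v p = b *s p" "B *v q = c *s q"
        using e1(2)[OF B(1)] B(2) disc[OF AG conjG[OF B(1) AG] L lox_conj[OF L BU]] by auto
      have A'G: "?A' \<in> mats G" using conjG[OF C(1) AG] .
      obtain d where d: "B *v r = d *s r"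
        using e2(2)[OF B(1)] B(2) disc[OF A'G conjG[OF B(1) A'G] L' lox_conj[OF L' BU]] r(1) by auto
      have "b = c" using equal_multipliers[OF BU bc d] herm_r by blast
      then have bq: "B *v q = b *s q" using bc by simp
      have b1: "b * cnj b = 1" using eigenvalues_reciprocal[OF BU bc(1) bq] by simp
            then have "cmod b = 1" by (rule cmod_eq_1)
      \<comment> \<open>A unit multiplier leaves the moduli of \<open>l\<close> and \<open>m\<close>
        unchanged, so \<open>A ** B\<close> is loxodromic and the hypothesis on two loxodromic
        generators reaches \<open>B\<close>.\<close>
      then have "lox p q (A ** B) (b * l) (b * m)"
        using l_gt BU by unfold_locales
          (simp_all add: bc(1) bq A_p A_q matvec_scale vector_smult_assoc norm_mult flip: matrix_vector_mul_assoc)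
      then have "pu_discrete (gen2 (cls A) (cls (A ** B)))"
        using disc[OF AG mgroupD(3)[OF mg AG B(1)] L] by blast
      then have "finite_order (cls B)"
        using finite_order_of_fixing[OF assms(1) _ _ BU bc(1) bq] AG B(1) by (simp add: mats_iff)
      moreover have "pt p \<in> fixset (cls B)" "pt q \<in> fixset (cls B)"
        using fixset_iff[OF BU] bc by auto
      ultimately have "B \<in> Q"
        using B infinite_fixset[OF BU bc(1) bq] by (simp add: Q_def)
      then show ?thesis using B(2) by auto
    qed
    then obtain f where f: "\<And>i. f i \<in> Q" "\<And>i. norm (f i - mat 1) < inverse (Suc i)" "inj (\<lambda>i. cls (f i))"
      using distinct_classes_sequence[of Q] by (auto simp: Q_def)
    have "limitin PU_top (\<lambda>i. cls (f i)) pu_one sequentially"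
      using f by (intro limitin_PU_one) (auto simp: Q_def mats_iff)
    moreover have "cls (f i) \<in> Gxy G x0 y0 \<and> finite_order (cls (f i)) \<and> infinite (fixset (cls (f i)))" for i
      using f(1)[of i] unfolding Gxy_def xy by (auto simp: Q_def mats_iff)
    ultimately show False using condA f(3) unfolding condition_A_def by blast
  qed
qed

end
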